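(* Consider a finite-space SSP game (as in the context) satisfying the Finite-Space SSP Game Model Assumption, and the Q-learning algorithm described in the context. Suppose algorithmic conditions (i), (ii), (iii) and (v) hold. Then for any given initial $Q_0$, the sequence $\{Q_t\}$ generated by the Q-learning algorithm is bounded with probability 1.
   Context: Finite-space game: $S=\{1,\dots,n\}$, $S_o=S\cup\{0\}$, $0$ absorbing cost-free termination state. At $i\in S$, players I and II have finite control sets $U(i),V(i)$; under $(u,v)$ the state moves to $j\in S_o$ w.p. $p_{ij}(u,v)$ with (deterministic, real) transition cost $\hat g(i,u,v,j)$ paid by player I to player II. $J(i;\pi_1,\pi_2)=\liminf_{t\to\infty}E_{\pi_1\pi_2}[\sum_{k=0}^t\hat g(i_k,u_k,v_k,i_{k+1})\mid i_0=i]$ for history-dependent randomized policies $\pi_1,\pi_2$. $\bar U(i)=\mathcal P(U(i))$, $\bar V(i)=\mathcal P(V(i))$; $\Pi_{1,SR},\Pi_{2,SR}$: stationary randomized policies. A pair of policies is prolonging if for some initial state the termination state is with positive probability never reached. Finite-Space SSP Game Model Assumption: (i) there is $\bar\mu\in\Pi_{1,SR}$ with $J(i;\bar\mu,\nu)<+\infty$ for all $\nu\in\Pi_{2,SR}$, all $i$; (ii) there is $\bar\nu\in\Pi_{2,SR}$ with $J(i;\mu,\bar\nu)>-\infty$ for all $\mu\in\Pi_{1,SR}$, all $i$; (iii) every prolonging pair in $\Pi_{1,SR}\times\Pi_{2,SR}$ has $J(i;\mu,\nu)\in\{+\infty,-\infty\}$ for some $i$. Q-learning: $R=\{(i,u,v):i\in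 S,u\in U(i),v\in V(i)\}$; set $U(0)=V(0)=\{0\}$ and treat Q-factor vectors $Q$ as indexed by $R\cup\{(0,0,0)\}$ with $Q(0,0,0)=0$. For a vector $Q$, state $s$, $\rho\in\mathcal P(U(s))$, $\sigma\in\mathcal P(V(s))$: $\underline Q(s,\rho,\sigma)=\sum_{\tilde u,\tilde v}\rho(\tilde u)\sigma(\tilde v)Q(s,\tilde u,\tilde v)$ (equal to $0$ when $s=0$). All variables live on a probability space $(\Omega,\mathcal F,\mathbf P)$ with a filtration $\{\mathcal F_t\}$. Given $Q_0$ and $\{Q_\tau,\tau\le t\}$, for each $\ell=(i,u,v)\in R$: a stepsize $\gamma_{t,\ell}\in[0,1]$, integers $0\le\tau_{\ell\tilde\ell}(t)\le t$ for $\tilde\ell\in R$, and a random successor state $j_t^\ell\in S_o$ are given; with $Q_t^{(\ell)}(\tilde\ell)=Q_{\tau_{\ell\tilde\ell}(t)}(\tilde\ell)$ and $s=j_t^\ell$, $Q_{t+1}(i,u,v)=(1-\gamma_{t,\ell})Q_t(i,u,v)+\gamma_{t,\ell}\big(\hat g(i,u,v,s)+\inf_{\rho\in\bar U(s)}\sup_{\sigma\in\bar V(s)}\underline{Q}^{(\ell)}_t(s,\rho,\sigma)\big)$. Algorithmic conditions: (i) $Q_0$ is $\mathcal F_0$-measurable; (ii) $\gamma_{t,\ell}$ and $\tau_{\ell\tilde\ell}(t)$ are $\mathcal F_t$-measurable; (iii) $j_t^\ell$ is $\mathcal F_{t+1}$-measurable and $\mathbf P(j_t^\ell=j\mid\mathcal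 F_t)=p_{ij}(u,v)$ for $j\in S_o$, $\ell=(i,u,v)$; (iv) w.p.1, $\lim_{t\to\infty}\tau_{\ell\tilde\ell}(t)=\infty$ for all $\ell,\tilde\ell\in R$; (v) w.p.1, $\sum_t\gamma_{t,\ell}=\infty$ and $\sum_t\gamma_{t,\ell}^2<\infty$ for all $\ell\in R$. *)

theory Defs
  imports "HOL-Probability.Probability"
begin

text \<open>States: S = {1..n}; termination state 0; S_o = {0..n}.
  Controls of player I at i: U i; of player II: V i.
  Transition probabilities p i u v j, transition costs g i u v j.\<close>

definition states :: "nat \<Rightarrow> nat set" where
  "states n = {1..n}"

definition ssp_game :: "nat \<Rightarrow> (nat \<Rightarrow> 'u set) \<Rightarrow> (nat \<Rightarrow> 'v set)
    \<Rightarrow> (nat \<Rightarrow> 'u \<Rightarrow> 'v \<Rightarrow> nat \<Rightarrow> real) \<Rightarrow> bool" where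
  "ssp_game n U V p \<longleftrightarrow>
     (\<forall>i\<in>states n. finite (U i) \<and> U i \<noteq> {} \<and> finite (V i) \<and> V i \<noteq> {} \<and>
        (\<forall>u\<in>U i. \<forall>v\<in>V i. (\<forall>j\<in>{0..n}. p i u v j \<ge> 0) \<and> (\<Sum>j\<in>{0..n}. p i u v j) = 1))"

definition SR_policies :: "nat \<Rightarrow> (nat \<Rightarrow> 'a set) \<Rightarrow> (nat \<Rightarrow> 'a pmf) set" where
  "SR_policies n U = {\<mu>. \<forall>i\<in>states n. set_pmf (\<mu> i) \<subseteq> U i}"

definition Ptrans :: "(nat \<Rightarrow> 'u set) \<Rightarrow> (nat \<Rightarrow> 'v set) \<Rightarrow> (nat \<Rightarrow> 'u \<Rightarrow> 'v \<Rightarrow> nat \<Rightarrow> real)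
    \<Rightarrow> (nat \<Rightarrow> 'u pmf) \<Rightarrow> (nat \<Rightarrow> 'v pmf) \<Rightarrow> nat \<Rightarrow> nat \<Rightarrow> real" where
  "Ptrans U V p \<mu> \<nu> i j =
     (\<Sum>u\<in>U i. \<Sum>v\<in>V i. pmf (\<mu> i) u * pmf (\<nu> i) v * p i u v j)"

definition stage_cost :: "nat \<Rightarrow> (nat \<Rightarrow> 'u set) \<Rightarrow> (nat \<Rightarrow> 'v set)
    \<Rightarrow> (nat \<Rightarrow> 'u \<Rightarrow> 'v \<Rightarrow> nat \<Rightarrow> real) \<Rightarrow> (nat \<Rightarrow> 'u \<Rightarrow> 'v \<Rightarrow> nat \<Rightarrow> real)
    \<Rightarrow> (nat \<Rightarrow> 'u pmf) \<Rightarrow> (nat \<Rightarrow> 'v pmf) \<Rightarrow> nat \<Rightarrow> real" where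
  "stage_cost n U V p g \<mu> \<nu> i =
     (\<Sum>u\<in>U i. \<Sum>v\<in>V i. pmf (\<mu> i) u * pmf (\<nu> i) v *
        (\<Sum>j\<in>{0..n}. p i u v j * g i u v j))"

text \<open>k-step probabilities P(i_k = l | i_0 = i) for l in S (the chain restricted to
  the non-terminated states; 0 is absorbing and cost-free).\<close>
fun kstep :: "nat \<Rightarrow> (nat \<Rightarrow> 'u set) \<Rightarrow> (nat \<Rightarrow> 'v set) \<Rightarrow> (nat \<Rightarrow> 'u \<Rightarrow> 'v \<Rightarrow> nat \<Rightarrow> real)
    \<Rightarrow> (nat \<Rightarrow> 'u pmf) \<Rightarrow> (nat \<Rightarrow> 'v pmf) \<Rightarrow> nat \<Rightarrow> nat \<Rightarrow> nat \<Rightarrow> real" where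
  "kstep n U V p \<mu> \<nu> 0 i l = (if i = l then 1 else 0)"
| "kstep n U V p \<mu> \<nu> (Suc k) i l =
     (\<Sum>m\<in>states n. kstep n U V p \<mu> \<nu> k i m * Ptrans U V p \<mu> \<nu> m l)"

text \<open>Cost J(i; mu, nu) = liminf_t E[sum_{k=0}^t g(i_k,u_k,v_k,i_{k+1}) | i_0 = i]
  (an extended real).\<close>
definition Jcost :: "nat \<Rightarrow> (nat \<Rightarrow> 'u set) \<Rightarrow> (nat \<Rightarrow> 'v set)
    \<Rightarrow> (nat \<Rightarrow> 'u \<Rightarrow> 'v \<Rightarrow> nat \<Rightarrow> real) \<Rightarrow> (nat \<Rightarrow> 'u \<Rightarrow> 'v \<Rightarrow> nat \<Rightarrow> real)
    \<Rightarrow> (nat \<Rightarrow> 'u pmf) \<Rightarrow> (nat \<Rightarrow> 'v pmf) \<Rightarrow> nat \<Rightarrow> ereal" where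
  "Jcost n U V p g \<mu> \<nu> i =
     liminf (\<lambda>t. ereal (\<Sum>k\<le>t. \<Sum>l\<in>states n.
        kstep n U V p \<mu> \<nu> k i l * stage_cost n U V p g \<mu> \<nu> l))"

text \<open>A pair is prolonging if for some initial state the termination state is,
  with positive probability, never reached, i.e. the probability
  P(i_k \<noteq> 0 for all k) = inf_k P(i_k \<in> S) is positive.\<close>
definition prolonging :: "nat \<Rightarrow> (nat \<Rightarrow> 'u set) \<Rightarrow> (nat \<Rightarrow> 'v set)
    \<Rightarrow> (nat \<Rightarrow> 'u \<Rightarrow> 'v \<Rightarrow> nat \<Rightarrow> real)
    \<Rightarrow> (nat \<Rightarrow> 'u pmf) \<Rightarrow> (nat \<Rightarrow> 'v pmf) \<Rightarrow> bool" where
  "prolonging n U V p \<mu> \<nu> \<longleftrightarrow>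
     (\<exists>i\<in>states n. (INF k. \<Sum>l\<in>states n. kstep n U V p \<mu> \<nu> k i l) > 0)"

definition SSP_model_assumption :: "nat \<Rightarrow> (nat \<Rightarrow> 'u set) \<Rightarrow> (nat \<Rightarrow> 'v set)
    \<Rightarrow> (nat \<Rightarrow> 'u \<Rightarrow> 'v \<Rightarrow> nat \<Rightarrow> real) \<Rightarrow> (nat \<Rightarrow> 'u \<Rightarrow> 'v \<Rightarrow> nat \<Rightarrow> real) \<Rightarrow> bool" where
  "SSP_model_assumption n U V p g \<longleftrightarrow>
     (\<exists>\<mu>\<in>SR_policies n U. \<forall>\<nu>\<in>SR_policies n V. \<forall>i\<in>states n.
         Jcost n U V p g \<mu> \<nu> i < \<infinity>) \<and>
     (\<exists>\<nu>\<in>SR_policies n V. \<forall>\<mu>\<in>SR_policies n U. \<forall>i\<in>states n.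
         Jcost n U V p g \<mu> \<nu> i > -\<infinity>) \<and>
     (\<forall>\<mu>\<in>SR_policies n U. \<forall>\<nu>\<in>SR_policies n V. prolonging n U V p \<mu> \<nu> \<longrightarrow>
         (\<exists>i\<in>states n. Jcost n U V p g \<mu> \<nu> i \<in> {\<infinity>, -\<infinity>}))"

definition Rset :: "nat \<Rightarrow> (nat \<Rightarrow> 'u set) \<Rightarrow> (nat \<Rightarrow> 'v set) \<Rightarrow> (nat \<times> 'u \<times> 'v) set" where
  "Rset n U V = {(i, u, v). i \<in> states n \<and> u \<in> U i \<and> v \<in> V i}"

text \<open>underline Q(s, rho, sigma); equal to 0 at s = 0 (Q(0,0,0) = 0).\<close>
definition Qmix :: "(nat \<Rightarrow> 'u set) \<Rightarrow> (nat \<Rightarrow> 'v set) \<Rightarrow> (nat \<times> 'u \<times> 'v \<Rightarrow> real)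
    \<Rightarrow> nat \<Rightarrow> 'u pmf \<Rightarrow> 'v pmf \<Rightarrow> real" where
  "Qmix U V Q s \<rho> \<sigma> = (if s = 0 then 0 else
     (\<Sum>u\<in>U s. \<Sum>v\<in>V s. pmf \<rho> u * pmf \<sigma> v * Q (s, u, v)))"

definition minmax_val :: "(nat \<Rightarrow> 'u set) \<Rightarrow> (nat \<Rightarrow> 'v set) \<Rightarrow> (nat \<times> 'u \<times> 'v \<Rightarrow> real)
    \<Rightarrow> nat \<Rightarrow> real" where
  "minmax_val U V Q s = (if s = 0 then 0 else
     (INF \<rho>\<in>{\<rho>. set_pmf \<rho> \<subseteq> U s}. SUP \<sigma>\<in>{\<sigma>. set_pmf \<sigma> \<subseteq> V s}. Qmix U V Q s \<rho> \<sigma>))"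

end

theory Submission
  imports Defs
begin

text \<open>Fixing the security policy of player II turns the lower bound into a statement about a
  one-player problem in which every stationary policy that avoids termination forever has cost
  \<open>+\<infinity>\<close> somewhere and no policy has cost \<open>-\<infinity>\<close>. By linear programming duality this problem has a
  strict subsolution \<open>L(i) + \<delta> \<le> g + \<Sum>\<^sub>j p\<^sub>i\<^sub>j L(j)\<close>: a dual certificate of infeasibility is an invariant
  occupation measure of nonpositive cost, and one of minimal support yields a prolonging policy
  whose partial costs stay bounded.

  Since the terminal value is \<open>0\<close>, every \<open>L - c\<close> with \<open>c \<ge> 0\<close> is again a strict subsolution with
  the same slack, and it is enough that the noise \<open>(g + L)(j\<^sub>t) - E[(g + L)(j\<^sub>t)]\<close>, which does not
  depend on \<open>c\<close>, stays below the slack. From a random time on it does, because its sum weighted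
  by square-summable stepsizes converges. Taking \<open>c\<close> large enough for the iterates up to that time,
  the bound \<open>Q\<^sub>t \<ge> E[g + L] - \<delta> - c\<close> is preserved by the iteration. The upper bound is symmetric.\<close>

section \<open>A transposition theorem\<close>

text \<open>With one player frozen, the other may still have policies that never terminate, so the
  dynamic programming operator need not be a contraction in any weighted norm. A strict one-sided
  inequality is weaker and still suffices, at the price of treating the two bounds with two
  different frozen policies and two potentials.

  The obstacle in the duality step is that the third model assumption promises an infinite cost at
  some state only. To contradict it, the partial costs must be bounded above from every state,
  whereas an occupation measure controls just a weighted total in which dear and cheap recurrent
  classes may cancel.

  On the stochastic side, noise that scales with the iterates would make the argument circular.
  Comparing with a fixed potential makes it a bounded function of the successor state, so the random
  time is fixed before the shift \<open>c\<close>, and \<open>c\<close> may depend on the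
  path.\<close>

text \<open>The flag of a vector marks its inequality as strict; the flag of a combination says that
  a strict inequality takes part in it.\<close>

inductive_set conic_comb :: "(('j \<Rightarrow> real) \<times> bool) set \<Rightarrow> (('j \<Rightarrow> real) \<times> bool) set" for A where
  base: "v \<in> A \<Longrightarrow> v \<in> conic_comb A"
| scale: "(a, s) \<in> conic_comb A \<Longrightarrow> 0 < r \<Longrightarrow> (\<lambda>j. r * a j, s) \<in> conic_comb A"
| add: "(a, s) \<in> conic_comb A \<Longrightarrow> (b, t) \<in> conic_comb A \<Longrightarrow> (\<lambda>j. a j + b j, s \<or> t) \<in> conic_comb A"

lemma conic_comb_minimal:
  assumes "v \<in> conic_comb A" "A \<subseteq> conic_comb B" shows "v \<in> conic_comb B"
  using assms(1) by induction (use assms(2) in \<open>auto intro: conic_comb.intros\<close>)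

lemma conic_comb_zero:
  assumes "v \<in> conic_comb A" "\<And>a s. (a, s) \<in> A \<Longrightarrow> a k = 0" shows "fst v k = 0"
  using assms(1) by induction (use assms(2) in \<open>auto\<close>)

text \<open>Turns a derivation into explicit multipliers. Distinct indices may give the same flagged
  vector; a generator then puts its whole weight on one of them, which is enough.\<close>

lemma conic_comb_image:
  assumes "v \<in> conic_comb ((\<lambda>k. (a k, k \<in> T)) ` K)" "finite K"
  shows "\<exists>x. (\<forall>k\<in>K. 0 \<le> x k) \<and> (snd v \<longrightarrow> (\<exists>k\<in>K \<inter> T. 0 < x k)) \<and> (\<forall>j. fst v j = (\<Sum>k\<in>K. x k * a k j))"
  using assms(1)
proof induction
  case (base v)
  then obtain k where k: "k \<in> K" "v = (a k, k \<in> T)" by auto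
  show ?case
    by (rule exI[of _ "\<lambda>k'. if k' = k then 1 else 0"]) (use k assms(2) in \<open>auto simp: if_distrib[of "\<lambda>x. x * _"] cong: if_cong\<close>)
next
  case (scale b s r)
  then obtain x where "\<forall>k\<in>K. 0 \<le> x k" "s \<longrightarrow> (\<exists>k\<in>K \<inter> T. 0 < x k)" "\<forall>j. b j = (\<Sum>k\<in>K. x k * a k j)" by auto
  then show ?case using scale.hyps
    by (intro exI[of _ "\<lambda>k. r * x k"]) (auto simp: sum_distrib_left mult.assoc intro!: bexI)
next
  case (add b s c t)
  then obtain x z where x: "\<forall>k\<in>K. 0 \<le> x k" "s \<longrightarrow> (\<exists>k\<in>K \<inter> T. 0 < x k)" "\<forall>j. b j = (\<Sum>k\<in>K. x k * a k j)"
    and z: "\<forall>k\<in>K. 0 \<le> z k" "t \<longrightarrow> (\<exists>k\<in>K \<inter> T. 0 < z k)" "\<forall>j. c j = (\<Sum>k\<in>K. z k * a k j)" by auto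
  have "\<exists>k\<in>K \<inter> T. 0 < x k + z k" if "s \<or> t"
    using x z that by (fastforce intro: add_pos_nonneg add_nonneg_pos)
  then show ?case using x z
    by (intro exI[of _ "\<lambda>k. x k + z k"]) (simp add: sum.distrib distrib_right)
qed

lemma real_between_finite_sets:
  fixes lo :: "'a \<Rightarrow> real" and hi :: "'b \<Rightarrow> real"
  assumes "finite A" "finite B"
    and le: "\<And>a b. a \<in> A \<Longrightarrow> b \<in> B \<Longrightarrow> lo a \<le> hi b"
    and less: "\<And>a b. a \<in> A \<Longrightarrow> b \<in> B \<Longrightarrow> S a \<or> T b \<Longrightarrow> lo a < hi b"
  shows "\<exists>z. (\<forall>a\<in>A. lo a \<le> z \<and> (S a \<longrightarrow> lo a < z)) \<and> (\<forall>b\<in>B. z \<le> hi b \<and> (T b \<longrightarrow> z < hi b))"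
proof (cases "A = {}")
  case True
  then show ?thesis
    using assms(2)
    by (cases "B = {}") (auto intro!: exI[of _ "Min (hi ` B) - 1"] simp: algebra_simps less_le_trans,
       (smt (verit) Min_le finite_imageI image_eqI)+)
next
  case A: False
  let ?l = "Max (lo ` A)"
  have l: "lo a \<le> ?l" if "a \<in> A" for a using that assms(1) by auto
  have "?l \<in> lo ` A" using A assms(1) by (intro Max_in) auto
  then obtain a0 where a0: "a0 \<in> A" "?l = lo a0" by blast
  show ?thesis
  proof (cases "B = {}")
    case True
    show ?thesis by (rule exI[of _ "?l + 1"]) (use l True in \<open>fastforce\<close>)
  next
    case B: False
    let ?u = "Min (hi ` B)"
    have u: "?u \<le> hi b" if "b \<in> B" for b using that assms(2) by auto
    have "?u \<in> hi ` B" using B assms(2) by (intro Min_in) auto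
    then obtain b0 where b0: "b0 \<in> B" "?u = hi b0" by blast
    \<comment> \<open>Strictness at \<open>a\<close> needs only the pair of \<open>a\<close> and
      \<open>b0\<close>: from \<open>lo a \<le> ?l\<close> and \<open>lo a < ?u\<close> the midpoint
      lies strictly above \<open>lo a\<close>, even though \<open>?l = ?u\<close> is possible
      otherwise.\<close>
    have "lo a \<le> (?l + ?u) / 2 \<and> (S a \<longrightarrow> lo a < (?l + ?u) / 2)" if "a \<in> A" for a
      using l[OF that] le[OF that b0(1)] less[OF that b0(1)] b0(2) by auto
    moreover have "(?l + ?u) / 2 \<le> hi b \<and> (T b \<longrightarrow> (?l + ?u) / 2 < hi b)" if "b \<in> B" for b
      using u[OF that] le[OF a0(1) that] less[OF a0(1) that] a0(2) by auto
    ultimately show ?thesis by blast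
  qed
qed

text \<open>Fourier--Motzkin elimination of one coordinate at a time.\<close>

lemma motzkin_conic_comb:
  assumes "finite J" "finite A"
  shows "(\<exists>y. \<forall>(a, s)\<in>A. 0 \<le> (\<Sum>j\<in>J. a j * y j) \<and> (s \<longrightarrow> 0 < (\<Sum>j\<in>J. a j * y j))) \<or>
         (\<exists>c. (c, True) \<in> conic_comb A \<and> (\<forall>j\<in>J. c j = 0))"
  using assms
proof (induction J arbitrary: A rule: finite_induct)
  case empty
  \<comment> \<open>Without coordinates every inequality reads \<open>0 \<le> 0\<close>, so the
    system fails exactly when some vector is strict, and that vector is then its own
    certificate.\<close>
  show ?case
  proof (cases "\<exists>a. (a, True) \<in> A")
    case True
    then show ?thesis by (blast intro: conic_comb.base)
  qed auto
next
  case (insert k J)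
  define P where "P = {v\<in>A. fst v k > 0}"
  define N where "N = {v\<in>A. fst v k < 0}"
  \<comment> \<open>The weights scale the entries at \<open>k\<close> to 1 and -1, so coordinate
    \<open>k\<close> cancels in the sum.\<close>
  define comb :: "('a \<Rightarrow> real) \<times> bool \<Rightarrow> ('a \<Rightarrow> real) \<times> bool \<Rightarrow> ('a \<Rightarrow> real) \<times> bool" where
    "comb = (\<lambda>v w. (\<lambda>j. inverse (fst v k) * fst v j + inverse (- fst w k) * fst w j, snd v \<or> snd w))"
  define A' where "A' = {v\<in>A. fst v k = 0} \<union> (\<lambda>(v, w). comb v w) ` (P \<times> N)"
  have fin: "finite P" "finite N" "finite A'"
    using insert.prems by (auto simp: P_def N_def A'_def)
  have A'_zero: "a k = 0" if "(a, s) \<in> A'" for a s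
    using that by (auto simp: A'_def comb_def P_def N_def)
  have A'_sub: "A' \<subseteq> conic_comb A"
  proof -
    have "comb v w \<in> conic_comb A" if "v \<in> P" "w \<in> N" for v w
      unfolding comb_def using that
      by (intro conic_comb.add conic_comb.scale) (auto simp: P_def N_def intro: conic_comb.base)
    then show ?thesis by (auto simp: A'_def intro: conic_comb.base)
  qed
  from insert.IH[OF fin(3)] show ?case
  proof
    assume "\<exists>c. (c, True) \<in> conic_comb A' \<and> (\<forall>j\<in>J. c j = 0)"
    then obtain c where c: "(c, True) \<in> conic_comb A'" "\<forall>j\<in>J. c j = 0" by auto
    have "c k = 0" using conic_comb_zero[OF c(1)] A'_zero by force
    then show ?thesis using c conic_comb_minimal[OF c(1) A'_sub] by auto
  next
    assume "\<exists>y. \<forall>(a, s)\<in>A'. 0 \<le> (\<Sum>j\<in>J. a j * y j) \<and> (s \<longrightarrow> 0 < (\<Sum>j\<in>J. a j * y j))"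
    then obtain y where y: "\<And>v. v \<in> A' \<Longrightarrow> 0 \<le> (\<Sum>j\<in>J. fst v j * y j) \<and> (snd v \<longrightarrow> 0 < (\<Sum>j\<in>J. fst v j * y j))"
      by force
    define d where "d v = (\<Sum>j\<in>J. fst v j * y j)" for v :: "('a \<Rightarrow> real) \<times> bool"
    \<comment> \<open>The combined inequality says precisely that the lower bound which
      \<open>v\<close> puts on the eliminated unknown does not exceed the upper bound coming from
      \<open>w\<close>.\<close>
    have dcomb: "(\<Sum>j\<in>J. fst (comb v w) j * y j) = d w / (- fst w k) - (- d v / fst v k)" for v w
    proof -
      have "(\<Sum>j\<in>J. fst (comb v w) j * y j) = inverse (fst v k) * d v + inverse (- fst w k) * d w"
        by (simp add: comb_def d_def sum_distrib_left algebra_simps sum_subtractf sum_negf)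
      then show ?thesis by (simp add: divide_inverse)
    qed
    have cA: "comb v w \<in> A'" if "v \<in> P" "w \<in> N" for v w using that by (auto simp: A'_def)
    have "\<exists>z. (\<forall>v\<in>P. - d v / fst v k \<le> z \<and> (snd v \<longrightarrow> - d v / fst v k < z)) \<and>
         (\<forall>w\<in>N. z \<le> d w / (- fst w k) \<and> (snd w \<longrightarrow> z < d w / (- fst w k)))"
      using y[OF cA] unfolding dcomb
      by (intro real_between_finite_sets fin) (auto simp: comb_def)
    then obtain z where z: "\<And>v. v \<in> P \<Longrightarrow> - d v / fst v k \<le> z \<and> (snd v \<longrightarrow> - d v / fst v k < z)"
      "\<And>w. w \<in> N \<Longrightarrow> z \<le> d w / (- fst w k) \<and> (snd w \<longrightarrow> z < d w / (- fst w k))" by blast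
    have dot: "(\<Sum>j\<in>insert k J. fst v j * (y(k := z)) j) = d v + fst v k * z" for v
    proof -
      have "(\<Sum>j\<in>J. fst v j * (y(k := z)) j) = d v"
        unfolding d_def using insert.hyps by (intro sum.cong) auto
      then show ?thesis using insert.hyps by simp
    qed
    have "0 \<le> d v + fst v k * z \<and> (snd v \<longrightarrow> 0 < d v + fst v k * z)" if "v \<in> A" for v
    proof -
      consider "fst v k = 0" | "v \<in> P" | "v \<in> N" using \<open>v \<in> A\<close> by (force simp: P_def N_def)
      then show ?thesis
      proof cases
        case 1
        then show ?thesis using y[of v] that by (auto simp: A'_def d_def)
      next
        case 2
        then have "fst v k > 0" by (simp add: P_def)
        then show ?thesis using z(1)[OF 2] by (auto simp: field_simps)
      next
        case 3
        then have "fst v k < 0" by (simp add: N_def)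
        then show ?thesis using z(2)[OF 3] by (auto simp: field_simps)
      qed
    qed
    then have "\<exists>y. \<forall>v\<in>A. 0 \<le> (\<Sum>j\<in>insert k J. fst v j * y j) \<and> (snd v \<longrightarrow> 0 < (\<Sum>j\<in>insert k J. fst v j * y j))"
      using dot by (intro exI[of _ "y(k := z)"]) presburger
    then show ?thesis by force
  qed
qed

text \<open>Indexed form of the elimination result. Taking all rows as strict gives Gordan's
  alternative; a single strict row that forces a scaling variable to be positive gives the
  inhomogeneous Farkas alternative. Both uses occur below.\<close>

lemma motzkin_transposition:
  fixes a :: "'k \<Rightarrow> 'j \<Rightarrow> real"
  assumes "finite J" "finite K"
  obtains y where "\<And>k. k \<in> K \<Longrightarrow> 0 \<le> (\<Sum>j\<in>J. a k j * y j)" "\<And>k. k \<in> K \<Longrightarrow> k \<in> T \<Longrightarrow> 0 < (\<Sum>j\<in>J. a k j * y j)"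
  | x k where "\<And>k. k \<in> K \<Longrightarrow> 0 \<le> x k" "k \<in> K" "k \<in> T" "0 < x k" "\<And>j. j \<in> J \<Longrightarrow> (\<Sum>k\<in>K. x k * a k j) = 0"
proof -
  let ?A = "(\<lambda>k. (a k, k \<in> T)) ` K"
  from motzkin_conic_comb[OF assms(1), of ?A] assms(2)
  consider y where "\<forall>(a, s)\<in>?A. 0 \<le> (\<Sum>j\<in>J. a j * y j) \<and> (s \<longrightarrow> 0 < (\<Sum>j\<in>J. a j * y j))"
    | c where "(c, True) \<in> conic_comb ?A" "\<forall>j\<in>J. c j = 0" by auto
  then show ?thesis
  proof cases
    case 1
    then show ?thesis by (intro that(1)[of y]) auto
  next
    case 2
    from conic_comb_image[OF 2(1) assms(2)] show ?thesis using 2(2) that(2) by force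
  qed
qed

section \<open>Finite substochastic and controlled chains\<close>

fun chain_power :: "'s set \<Rightarrow> ('s \<Rightarrow> 's \<Rightarrow> real) \<Rightarrow> nat \<Rightarrow> 's \<Rightarrow> 's \<Rightarrow> real" where
  "chain_power N P 0 i l = (if i = l then 1 else 0)"
| "chain_power N P (Suc k) i l = (\<Sum>m\<in>N. chain_power N P k i m * P m l)"

text \<open>\<open>N\<close> holds the non-terminated states; the mass missing from a row is the
  probability of terminating in that step.\<close>

locale substochastic =
  fixes N :: "'s set" and P :: "'s \<Rightarrow> 's \<Rightarrow> real"
  assumes finite_states: "finite N"
    and nonneg: "i \<in> N \<Longrightarrow> j \<in> N \<Longrightarrow> 0 \<le> P i j"
    and row_sum_le_1: "i \<in> N \<Longrightarrow> (\<Sum>j\<in>N. P i j) \<le> 1"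
begin

definition invariant :: "('s \<Rightarrow> real) \<Rightarrow> bool" where
  "invariant x \<longleftrightarrow> (\<forall>i\<in>N. 0 \<le> x i) \<and> (\<forall>j\<in>N. (\<Sum>i\<in>N. x i * P i j) = x j)"

lemma chain_power_nonneg: "i \<in> N \<Longrightarrow> l \<in> N \<Longrightarrow> 0 \<le> chain_power N P k i l"
  by (induction k arbitrary: l) (auto intro!: sum_nonneg mult_nonneg_nonneg nonneg)

lemma chain_power_Suc_sum:
  "(\<Sum>l\<in>N. chain_power N P (Suc k) i l * h l) = (\<Sum>m\<in>N. chain_power N P k i m * (\<Sum>l\<in>N. P m l * h l))"
proof -
  have "(\<Sum>l\<in>N. chain_power N P (Suc k) i l * h l) = (\<Sum>l\<in>N. \<Sum>m\<in>N. chain_power N P k i m * (P m l * h l))"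
    by (simp add: sum_distrib_right mult.assoc)
  also have "\<dots> = (\<Sum>m\<in>N. \<Sum>l\<in>N. chain_power N P k i m * (P m l * h l))" by (rule sum.swap)
  finally show ?thesis by (simp add: sum_distrib_left)
qed

lemma chain_power_row_sum_le_1: "i \<in> N \<Longrightarrow> (\<Sum>l\<in>N. chain_power N P k i l) \<le> 1"
proof (induction k)
  case 0
  then show ?case using finite_states by simp
next
  case (Suc k)
  have "(\<Sum>l\<in>N. chain_power N P (Suc k) i l) = (\<Sum>m\<in>N. chain_power N P k i m * (\<Sum>l\<in>N. P m l))"
    using chain_power_Suc_sum[of k i "\<lambda>_. 1"] by simp
  also have "\<dots> \<le> (\<Sum>m\<in>N. chain_power N P k i m * 1)"
    using Suc.prems by (intro sum_mono mult_left_mono row_sum_le_1 chain_power_nonneg)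
  finally show ?case using Suc by simp
qed

lemma chain_power_closed:
  assumes C: "C \<subseteq> N" "i \<in> C"
    and closed: "\<And>i. i \<in> C \<Longrightarrow> (\<Sum>j\<in>N. P i j) = 1" "\<And>i j. i \<in> C \<Longrightarrow> j \<in> N - C \<Longrightarrow> P i j = 0"
  shows "(\<Sum>l\<in>N. chain_power N P k i l) = 1"
proof -
  \<comment> \<open>The two claims need each other: the total stays 1 only because all mass sits in
    \<open>C\<close>, where the rows are full.\<close>
  have "(\<forall>l\<in>N - C. chain_power N P k i l = 0) \<and> (\<Sum>l\<in>N. chain_power N P k i l) = 1"
  proof (induction k)
    case 0
    then show ?case using finite_states C by auto
  next
    case (Suc k)
    have "chain_power N P k i m * P m l = 0" if "m \<in> N" "l \<in> N - C" for m l
      using Suc closed(2)[of m l] that by (cases "m \<in> C") auto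
    moreover have "(\<Sum>l\<in>N. chain_power N P (Suc k) i l) = (\<Sum>m\<in>N. chain_power N P k i m * (\<Sum>l\<in>N. P m l))"
      using chain_power_Suc_sum[of k i "\<lambda>_. 1"] by simp
    moreover have "\<dots> = (\<Sum>m\<in>N. chain_power N P k i m)"
      using Suc closed(1) by (intro sum.cong) auto
    ultimately show ?case using Suc by (simp add: sum.neutral)
  qed
  then show ?thesis ..
qed

text \<open>Summing the invariance equations over all states shows that the total leakage is zero,
  and its terms are nonnegative. Likewise, invariance at a state without mass leaves no room for
  inflow from the support.\<close>

lemma invariant_support_closed:
  assumes x: "invariant x" and i: "i \<in> N" "0 < x i"
  shows "(\<Sum>j\<in>N. P i j) = 1" "\<And>j. j \<in> N \<Longrightarrow> x j = 0 \<Longrightarrow> P i j = 0"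
proof -
  have "(\<Sum>i\<in>N. x i * (1 - (\<Sum>j\<in>N. P i j))) = (\<Sum>i\<in>N. x i) - (\<Sum>j\<in>N. \<Sum>i\<in>N. x i * P i j)"
    by (subst sum.swap) (simp add: algebra_simps sum_subtractf sum_distrib_left)
  also have "\<dots> = 0" using x by (simp add: invariant_def)
  finally have "(\<Sum>i\<in>N. x i * (1 - (\<Sum>j\<in>N. P i j))) = 0" .
  then have "x i * (1 - (\<Sum>j\<in>N. P i j)) = 0"
    using x i by (subst (asm) sum_nonneg_eq_0_iff) (auto simp: invariant_def finite_states row_sum_le_1)
  then show "(\<Sum>j\<in>N. P i j) = 1" using i by simp
  fix j assume j: "j \<in> N" "x j = 0"
  then have "(\<Sum>i\<in>N. x i * P i j) = 0" using x by (simp add: invariant_def)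
  then have "x i * P i j = 0"
    using x i j by (subst (asm) sum_nonneg_eq_0_iff) (auto simp: invariant_def finite_states nonneg)
  then show "P i j = 0" using i by simp
qed

lemma invariant_imp_mass_conserved:
  assumes "invariant x" "i \<in> N" "0 < x i"
  shows "(\<Sum>l\<in>N. chain_power N P k i l) = 1"
proof (rule chain_power_closed[of "{i\<in>N. 0 < x i}"])
  fix i j assume "i \<in> {i\<in>N. 0 < x i}" "j \<in> N - {i\<in>N. 0 < x i}"
  then show "P i j = 0" using invariant_support_closed(2)[OF assms(1), of i j] assms(1)
    by (auto simp: invariant_def order.antisym not_less)
qed (use assms invariant_support_closed(1)[OF assms(1)] in auto)

text \<open>The multipliers of the dual alternative would form a nonzero invariant measure, so
  \<open>y - P y > 0\<close> is solvable. The result \<open>e\<close> dominates the expected time to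
  termination.\<close>

lemma expected_time_bound:
  assumes transient: "\<And>x i. invariant x \<Longrightarrow> i \<in> N \<Longrightarrow> x i = 0"
  obtains e where "\<And>i. i \<in> N \<Longrightarrow> 0 \<le> e i" "\<And>i. i \<in> N \<Longrightarrow> 1 + (\<Sum>j\<in>N. P i j * e j) \<le> e i"
proof (cases "N = {}")
  case True
  then show ?thesis using that by auto
next
  case ne: False
  let ?a = "\<lambda>i j. (if i = j then 1 else 0) - P i j"
  have dot: "(\<Sum>j\<in>N. ?a i j * y j) = y i - (\<Sum>j\<in>N. P i j * y j)" if "i \<in> N" for i y
    using that finite_states
    by (simp add: left_diff_distrib sum_subtractf if_distrib[of "\<lambda>x. x * _"] cong: if_cong)
  have dot': "(\<Sum>i\<in>N. x i * ?a i j) = x j - (\<Sum>i\<in>N. x i * P i j)" if "j \<in> N" for j x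
    using that finite_states
    by (simp add: right_diff_distrib sum_subtractf if_distrib[of "\<lambda>x. _ * x"] cong: if_cong)
  show ?thesis
  proof (rule motzkin_transposition[OF finite_states finite_states, of ?a N])
    fix y
    assume "\<And>i. i \<in> N \<Longrightarrow> i \<in> N \<Longrightarrow> 0 < (\<Sum>j\<in>N. ?a i j * y j)"
    then have y: "(\<Sum>j\<in>N. P i j * y j) < y i" if "i \<in> N" for i using dot that by simp
    have "Min (y ` N) \<in> y ` N" using finite_states ne by (intro Min_in) auto
    then obtain k where k: "k \<in> N" "Min (y ` N) = y k" by blast
    have k_min: "y k \<le> y i" if "i \<in> N" for i using that finite_states k(2)[symmetric] by simp
    \<comment> \<open>Minimum principle: at a negative minimum, a row of mass at most 1 averages to
      at least \<open>y k\<close>, contradicting the strict inequality.\<close>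
    have "0 \<le> y k"
    proof (rule ccontr)
      assume neg: "\<not> 0 \<le> y k"
      have "y k \<le> y k * (\<Sum>j\<in>N. P k j)"
        using neg row_sum_le_1[OF k(1)] mult_left_mono_neg[of "\<Sum>j\<in>N. P k j" 1 "y k"] by simp
      also have "\<dots> \<le> (\<Sum>j\<in>N. P k j * y j)"
        unfolding sum_distrib_left
      proof (rule sum_mono)
        fix j assume "j \<in> N"
        then show "y k * P k j \<le> P k j * y j"
          using mult_left_mono[OF k_min nonneg[OF k(1)]] by (simp add: mult.commute)
      qed
      finally show False using y[OF k(1)] by simp
    qed
    \<comment> \<open>The smallest slack; dividing by it normalises every slack to at least
      1.\<close>
    define d where "d = Min ((\<lambda>i. y i - (\<Sum>j\<in>N. P i j * y j)) ` N)"
    have d: "0 < d" "\<And>i. i \<in> N \<Longrightarrow> d \<le> y i - (\<Sum>j\<in>N. P i j * y j)"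
      using y ne finite_states by (auto simp: d_def)
    show ?thesis
    proof (rule that[of "\<lambda>i. y i / d"])
      fix i assume i: "i \<in> N"
      show "0 \<le> y i / d" using d \<open>0 \<le> y k\<close> k_min[OF i] by simp
      have "(d + (\<Sum>j\<in>N. P i j * y j)) / d \<le> y i / d" using d(2)[OF i] d(1) by (intro divide_right_mono) auto
      then show "1 + (\<Sum>j\<in>N. P i j * (y j / d)) \<le> y i / d"
        using d(1) by (simp add: add_divide_distrib sum_divide_distrib)
    qed
  next
    fix x k
    assume x: "\<And>i. i \<in> N \<Longrightarrow> 0 \<le> x i" "k \<in> N" "0 < x k" "\<And>j. j \<in> N \<Longrightarrow> (\<Sum>i\<in>N. x i * ?a i j) = 0"
    then have "invariant x" using dot' by (auto simp: invariant_def)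
    then show ?thesis using transient[of x k] x by simp
  qed
qed

text \<open>Along the chain the inequality telescopes: the cost up to time \<open>t\<close> is at
  most \<open>H i\<close> minus the expected value of \<open>H\<close> at time \<open>t + 1\<close>.
  The bound depends neither on \<open>t\<close> nor on the initial state.\<close>

lemma total_cost_bounded:
  assumes H: "\<And>i. i \<in> N \<Longrightarrow> f i + (\<Sum>j\<in>N. P i j * H j) \<le> H i" and i: "i \<in> N"
  shows "(\<Sum>k\<le>t. \<Sum>l\<in>N. chain_power N P k i l * f l) \<le> 2 * (\<Sum>j\<in>N. \<bar>H j\<bar>)"
proof -
  let ?K = "chain_power N P"
  have step: "(\<Sum>l\<in>N. ?K k i l * f l) \<le> (\<Sum>l\<in>N. ?K k i l * H l) - (\<Sum>l\<in>N. ?K (Suc k) i l * H l)" for k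
  proof -
    have "(\<Sum>l\<in>N. ?K k i l * f l) + (\<Sum>l\<in>N. ?K (Suc k) i l * H l)
        = (\<Sum>l\<in>N. ?K k i l * (f l + (\<Sum>j\<in>N. P l j * H j)))"
      unfolding chain_power_Suc_sum by (simp only: distrib_left sum.distrib)
    also have "\<dots> \<le> (\<Sum>l\<in>N. ?K k i l * H l)"
      by (intro sum_mono mult_left_mono H chain_power_nonneg i)
    finally show ?thesis by simp
  qed
  have tele: "(\<Sum>k\<le>t. \<Sum>l\<in>N. ?K k i l * f l) \<le> H i - (\<Sum>l\<in>N. ?K (Suc t) i l * H l)"
  proof (induction t)
    case 0
    have "(\<Sum>l\<in>N. ?K 0 i l * H l) = H i"
      using i finite_states by (simp add: if_distrib[of "\<lambda>x. x * _"] cong: if_cong)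
    then show ?case using step[of 0] by simp
  next
    case (Suc t)
    then show ?case using step[of "Suc t"] by (simp del: chain_power.simps)
  qed
  have le1: "?K k i l \<le> 1" if "l \<in> N" for k l
    using member_le_sum[of l N "?K k i"] chain_power_row_sum_le_1[OF i, of k] chain_power_nonneg[OF i] finite_states that
    by force
  have "\<bar>\<Sum>l\<in>N. ?K (Suc t) i l * H l\<bar> \<le> (\<Sum>l\<in>N. 1 * \<bar>H l\<bar>)"
    using le1 chain_power_nonneg[OF i]
    by (intro order.trans[OF sum_abs] sum_mono) (simp only: abs_mult, intro mult_right_mono, auto simp del: chain_power.simps)
  moreover have "\<bar>H i\<bar> \<le> (\<Sum>l\<in>N. \<bar>H l\<bar>)" using i finite_states by (intro member_le_sum) auto
  ultimately show ?thesis using tele by simp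
qed

end

section \<open>Controlled chains: potentials, occupation measures and policies of bounded
  cost\<close>

locale controlled_chain =
  fixes N :: "'s set" and W :: "'s \<Rightarrow> 'w set" and q :: "'s \<Rightarrow> 'w \<Rightarrow> 's \<Rightarrow> real" and r :: "'s \<Rightarrow> 'w \<Rightarrow> real"
  assumes finite_states: "finite N"
    and finite_controls: "i \<in> N \<Longrightarrow> finite (W i)"
    and trans_nonneg: "i \<in> N \<Longrightarrow> w \<in> W i \<Longrightarrow> j \<in> N \<Longrightarrow> 0 \<le> q i w j"
    and trans_sum_le_1: "i \<in> N \<Longrightarrow> w \<in> W i \<Longrightarrow> (\<Sum>j\<in>N. q i w j) \<le> 1"
begin

text \<open>Real weights instead of \<open>pmf\<close>s, because policies arise by normalising
  occupation measures; \<open>pmf_policy_exists\<close> translates back.\<close>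

definition policy :: "('s \<Rightarrow> 'w \<Rightarrow> real) \<Rightarrow> bool" where
  "policy m \<longleftrightarrow> (\<forall>i\<in>N. (\<forall>w\<in>W i. 0 \<le> m i w) \<and> (\<Sum>w\<in>W i. m i w) = 1)"

definition kernel :: "('s \<Rightarrow> 'w \<Rightarrow> real) \<Rightarrow> 's \<Rightarrow> 's \<Rightarrow> real" where
  "kernel m i j = (\<Sum>w\<in>W i. m i w * q i w j)"

definition cost :: "('s \<Rightarrow> 'w \<Rightarrow> real) \<Rightarrow> 's \<Rightarrow> real" where
  "cost m i = (\<Sum>w\<in>W i. m i w * r i w)"

lemma substochastic_kernel:
  assumes "policy m" shows "substochastic N (kernel m)"
proof
  show "finite N" by (rule finite_states)
  fix i assume i: "i \<in> N"
  have "(\<Sum>j\<in>N. kernel m i j) = (\<Sum>w\<in>W i. m i w * (\<Sum>j\<in>N. q i w j))"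
    unfolding kernel_def by (subst sum.swap) (simp add: sum_distrib_left)
  also have "\<dots> \<le> (\<Sum>w\<in>W i. m i w * 1)"
    using assms i by (intro sum_mono mult_left_mono trans_sum_le_1) (auto simp: policy_def)
  finally show "(\<Sum>j\<in>N. kernel m i j) \<le> 1" using assms i by (simp add: policy_def)
qed (use assms in \<open>auto simp: policy_def kernel_def trans_nonneg intro!: sum_nonneg\<close>)

text \<open>The dual feasible set: unnormalised stationary state-control frequencies, nonzero and of
  nonpositive total cost.\<close>

definition occupation :: "('s \<Rightarrow> 'w \<Rightarrow> real) \<Rightarrow> bool" where
  "occupation x \<longleftrightarrow> (\<forall>i\<in>N. \<forall>w\<in>W i. 0 \<le> x i w) \<and>
     (\<forall>j\<in>N. (\<Sum>i\<in>N. \<Sum>w\<in>W i. x i w * q i w j) = (\<Sum>w\<in>W j. x j w)) \<and>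
     (\<exists>i\<in>N. 0 < (\<Sum>w\<in>W i. x i w)) \<and>
     (\<Sum>i\<in>N. \<Sum>w\<in>W i. x i w * r i w) \<le> 0"

text \<open>The inhomogeneous system is made homogeneous by a scaling coordinate
  \<open>None\<close>; row \<open>None\<close> requires it to be positive, and the rows of
  state-control pairs carry the cost as its coefficient.\<close>

lemma subsolution_or_occupation:
  obtains L d where "0 < d"
      "\<And>i w. i \<in> N \<Longrightarrow> w \<in> W i \<Longrightarrow> L i + d \<le> r i w + (\<Sum>j\<in>N. q i w j * L j)"
  | x where "occupation x"
proof -
  define K where "K = insert None (Some ` Sigma N W)"
  define J where "J = insert None (Some ` N)"
  define a :: "('s \<times> 'w) option \<Rightarrow> 's option \<Rightarrow> real" where
    "a k j = (case k of None \<Rightarrow> (if j = None then 1 else 0)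
        | Some (i, w) \<Rightarrow> (case j of None \<Rightarrow> r i w | Some j \<Rightarrow> q i w j - (if i = j then 1 else 0)))" for k j
  have fin: "finite (Sigma N W)" using finite_states finite_controls by (intro finite_SigmaI)
  have sumK: "(\<Sum>k\<in>K. f k) = f None + (\<Sum>i\<in>N. \<Sum>w\<in>W i. f (Some (i, w)))" for f :: "_ \<Rightarrow> real"
    using fin finite_states finite_controls
    by (simp add: K_def sum.reindex sum.Sigma case_prod_beta del: Sigma_def)
  have sumJ: "(\<Sum>j\<in>J. f j) = f None + (\<Sum>j\<in>N. f (Some j))" for f :: "_ \<Rightarrow> real"
    using finite_states by (simp add: J_def sum.reindex)
  have "finite J" "finite K" using fin finite_states by (auto simp: J_def K_def)
  then show ?thesis
  proof (rule motzkin_transposition[of J K a UNIV])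
    fix y assume y: "\<And>k. k \<in> K \<Longrightarrow> k \<in> UNIV \<Longrightarrow> 0 < (\<Sum>j\<in>J. a k j * y j)"
    have pos: "0 < y None" using y[of None] by (simp add: K_def sumJ a_def)
    define L where "L j = y (Some j) / y None" for j
    define D where "D = (\<lambda>(i, w). r i w + (\<Sum>j\<in>N. q i w j * L j) - L i) ` Sigma N W"
    have "0 < r i w + (\<Sum>j\<in>N. q i w j * L j) - L i" if "i \<in> N" "w \<in> W i" for i w
    proof -
      have "0 < r i w * y None + (\<Sum>j\<in>N. (q i w j - (if i = j then 1 else 0)) * y (Some j))"
        using y[of "Some (i, w)"] that by (simp add: K_def sumJ a_def)
      also have "\<dots> = r i w * y None + (\<Sum>j\<in>N. q i w j * y (Some j)) - y (Some i)"
        using that finite_states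
        by (simp add: left_diff_distrib sum_subtractf if_distrib[of "\<lambda>x. x * _"] cong: if_cong)
      also have "\<dots> = y None * (r i w + (\<Sum>j\<in>N. q i w j * L j) - L i)"
        using pos by (simp add: L_def distrib_left right_diff_distrib sum_distrib_left mult.commute)
      finally show ?thesis using pos by (simp add: zero_less_mult_iff)
    qed
    then have D: "\<forall>d\<in>D. 0 < d" "finite D" using fin by (auto simp: D_def)
    \<comment> \<open>The extra 1 keeps the minimum meaningful if there are no state-control
      pairs.\<close>
    have "0 < Min (insert 1 D)" using D by simp
    moreover have "Min (insert 1 D) \<le> r i w + (\<Sum>j\<in>N. q i w j * L j) - L i" if "i \<in> N" "w \<in> W i" for i w
      using D that by (intro Min_le) (auto simp: D_def)
    ultimately show ?thesis by (intro that(1)[of "Min (insert 1 D)" L]) (simp_all add: algebra_simps)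
  next
    fix x k
    assume x: "\<And>k. k \<in> K \<Longrightarrow> 0 \<le> x k" and k: "k \<in> K" "0 < x k"
      and eq: "\<And>j. j \<in> J \<Longrightarrow> (\<Sum>k\<in>K. x k * a k j) = 0"
    let ?x = "\<lambda>i w. x (Some (i, w))"
    have nn: "0 \<le> ?x i w" if "i \<in> N" "w \<in> W i" for i w using x[of "Some (i, w)"] that by (simp add: K_def)
    have cost0: "x None + (\<Sum>i\<in>N. \<Sum>w\<in>W i. ?x i w * r i w) = 0"
      using eq[of None] by (simp add: sumK J_def a_def)
    have "occupation ?x"
      unfolding occupation_def
    proof (intro conjI ballI)
      fix j assume j: "j \<in> N"
      have "0 = (\<Sum>i\<in>N. \<Sum>w\<in>W i. ?x i w * (q i w j - (if i = j then 1 else 0)))"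
        using eq[of "Some j"] j by (simp add: sumK J_def a_def)
      also have "\<dots> = (\<Sum>i\<in>N. (\<Sum>w\<in>W i. ?x i w * q i w j) - (if i = j then \<Sum>w\<in>W i. ?x i w else 0))"
        by (intro sum.cong) (auto simp: right_diff_distrib sum_subtractf)
      also have "\<dots> = (\<Sum>i\<in>N. \<Sum>w\<in>W i. ?x i w * q i w j) - (\<Sum>w\<in>W j. ?x j w)"
        using j finite_states by (simp add: sum_subtractf)
      finally show "(\<Sum>i\<in>N. \<Sum>w\<in>W i. ?x i w * q i w j) = (\<Sum>w\<in>W j. ?x j w)" by simp
    next
      \<comment> \<open>If all state masses vanished, \<open>cost0\<close> would make the multiplier
        of row \<open>None\<close> vanish as well, and no positive multiplier would remain.\<close>
      show "\<exists>i\<in>N. 0 < (\<Sum>w\<in>W i. ?x i w)"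
      proof (rule ccontr)
        assume "\<not> ?thesis"
        then have "(\<Sum>w\<in>W i. ?x i w) = 0" if "i \<in> N" for i
          using that nn by (meson linorder_not_less order.antisym sum_nonneg)
        then have zero: "?x i w = 0" if "i \<in> N" "w \<in> W i" for i w
          using that nn finite_controls by (simp add: sum_nonneg_eq_0_iff)
        then have "x None = 0" using cost0 by simp
        then show False using k zero by (auto simp: K_def)
      qed
    next
      show "(\<Sum>i\<in>N. \<Sum>w\<in>W i. ?x i w * r i w) \<le> 0" using cost0 x[of None] by (simp add: K_def)
    qed (use nn in auto)
    then show ?thesis by (rule that(2))
  qed
qed

text \<open>On the support \<open>C\<close> of a minimal occupation measure the policy uses its
  normalised frequencies, which keeps the chain in \<open>C\<close> forever; elsewhere it follows
  \<open>m0\<close>. A supersolution \<open>H\<close> glued from the two regions bounds the cost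
  from every state, inside or outside \<open>C\<close>.\<close>

lemma occupation_imp_bounded_policy:
  assumes occ: "occupation x0" and m0: "policy m0"
    and transient: "\<And>x i. substochastic.invariant N (kernel m0) x \<Longrightarrow> i \<in> N \<Longrightarrow> x i = 0"
  obtains m i B where "policy m" "i \<in> N" "\<And>k. (\<Sum>l\<in>N. chain_power N (kernel m) k i l) = 1"
    "\<And>i t. i \<in> N \<Longrightarrow> (\<Sum>k\<le>t. \<Sum>l\<in>N. chain_power N (kernel m) k i l * cost m l) \<le> B"
proof -
  define supp where "supp x = {i\<in>N. 0 < (\<Sum>w\<in>W i. x i w)}" for x :: "'s \<Rightarrow> 'w \<Rightarrow> real"
  obtain x where x: "occupation x" and minimal: "\<And>y. occupation y \<Longrightarrow> card (supp x) \<le> card (supp y)"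
    using ex_has_least_nat[of occupation x0 "\<lambda>x. card (supp x)"] occ by blast
  define C where "C = supp x"
  define X where "X i = (\<Sum>w\<in>W i. x i w)" for i
  have C: "C \<subseteq> N" "finite C" "C \<noteq> {}" "\<And>i. i \<in> C \<Longrightarrow> 0 < X i"
    using x finite_states by (auto simp: C_def supp_def X_def occupation_def)
  have x_nonneg: "0 \<le> x i w" if "i \<in> N" "w \<in> W i" for i w using x that by (auto simp: occupation_def)
  have X_nonneg: "0 \<le> X i" if "i \<in> N" for i using that x_nonneg by (auto simp: X_def intro: sum_nonneg)
  have X_zero: "X i = 0" if "i \<in> N" "i \<notin> C" for i
    using that X_nonneg[of i] by (auto simp: C_def supp_def X_def)
  have x_zero: "x i w = 0" if "i \<in> N" "i \<notin> C" "w \<in> W i" for i w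
    using X_zero[OF that(1,2)] x_nonneg finite_controls that by (simp add: X_def sum_nonneg_eq_0_iff)
  define m where "m i w = (if i \<in> C then x i w / X i else m0 i w)" for i w
  define P where "P = kernel m"
  define f where "f = cost m"
  have m: "policy m"
    unfolding policy_def
  proof (intro ballI conjI)
    fix i assume i: "i \<in> N"
    show "0 \<le> m i w" if "w \<in> W i" for w
      using that i m0 x_nonneg X_nonneg by (auto simp: m_def policy_def)
    show "(\<Sum>w\<in>W i. m i w) = 1"
    proof (cases "i \<in> C")
      case True
      then have "(\<Sum>w\<in>W i. m i w) = X i / X i" by (simp add: m_def X_def flip: sum_divide_distrib)
      then show ?thesis using C(4)[OF True] by simp
    qed (use m0 i in \<open>auto simp: m_def policy_def\<close>)
  qed
  interpret P: substochastic N P unfolding P_def by (rule substochastic_kernel[OF m])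
  interpret P0: substochastic N "kernel m0" by (rule substochastic_kernel[OF m0])
  have mX: "m i w * X i = x i w" if "i \<in> N" "w \<in> W i" for i w
    using that C(4)[of i] X_zero x_zero by (cases "i \<in> C") (auto simp: m_def)
  have XP: "X i * P i j = (\<Sum>w\<in>W i. x i w * q i w j)" if "i \<in> N" for i j
    unfolding P_def kernel_def sum_distrib_left
    by (intro sum.cong) (use that in \<open>auto simp flip: mX\<close>)
  have Xf: "X i * f i = (\<Sum>w\<in>W i. x i w * r i w)" if "i \<in> N" for i
    unfolding f_def cost_def sum_distrib_left
    by (intro sum.cong) (use that in \<open>auto simp flip: mX\<close>)
  have invX: "P.invariant X"
    using x X_nonneg by (simp add: P.invariant_def XP occupation_def) (simp add: X_def)
  have closed: "P i j = 0" if "i \<in> C" "j \<in> N - C" for i j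
    using P.invariant_support_closed(2)[OF invX _ C(4)[OF that(1)]] that C(1) X_zero by auto
  have sumC: "(\<Sum>j\<in>N. P i j * z j) = (\<Sum>j\<in>C. P i j * z j)" if "i \<in> C" for i z
    using that C(1) finite_states closed by (intro sum.mono_neutral_right) auto
  have sum_Xf: "(\<Sum>i\<in>C. X i * f i) \<le> 0"
  proof -
    have "(\<Sum>i\<in>C. X i * f i) = (\<Sum>i\<in>N. X i * f i)"
      using C(1) finite_states X_zero by (intro sum.mono_neutral_left) auto
    then show ?thesis using x by (simp add: Xf occupation_def)
  qed

  \<comment> \<open>A Poisson-type inequality on \<open>C\<close>. Only the scaling row is strict,
    so a failure yields a measure on \<open>C\<close>, invariant under \<open>P\<close>, of strictly
    positive cost.\<close>
  obtain h where h: "\<And>i. i \<in> C \<Longrightarrow> f i + (\<Sum>j\<in>C. P i j * h j) \<le> h i"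
  proof -
    define J where "J = insert None (Some ` C)"
    define a :: "'s option \<Rightarrow> 's option \<Rightarrow> real" where
      "a k j = (case k of None \<Rightarrow> (if j = None then 1 else 0)
          | Some i \<Rightarrow> (case j of None \<Rightarrow> - f i | Some j \<Rightarrow> (if i = j then 1 else 0) - P i j))" for k j
    have sumJ: "(\<Sum>j\<in>J. F j) = F None + (\<Sum>j\<in>C. F (Some j))" for F :: "_ \<Rightarrow> real"
      using C(2) by (simp add: J_def sum.reindex)
    have memJ: "None \<in> J" "\<And>i. i \<in> C \<Longrightarrow> Some i \<in> J" by (auto simp: J_def)
    have "finite J" using C(2) by (simp add: J_def)
    then show ?thesis
    proof (rule motzkin_transposition[of J J a "{None}"])
      show "finite J" by fact
      fix y assume y: "\<And>k. k \<in> J \<Longrightarrow> 0 \<le> (\<Sum>j\<in>J. a k j * y j)"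
        "\<And>k. k \<in> J \<Longrightarrow> k \<in> {None} \<Longrightarrow> 0 < (\<Sum>j\<in>J. a k j * y j)"
      have pos: "0 < y None" using y(2)[of None] by (simp add: memJ sumJ a_def)
      have "f i + (\<Sum>j\<in>C. P i j * (y (Some j) / y None)) \<le> y (Some i) / y None" if "i \<in> C" for i
      proof -
        have "0 \<le> - f i * y None + (\<Sum>j\<in>C. ((if i = j then 1 else 0) - P i j) * y (Some j))"
          using y(1)[of "Some i"] that by (simp add: memJ sumJ a_def)
        also have "\<dots> = y (Some i) - (\<Sum>j\<in>C. P i j * y (Some j)) - f i * y None"
          using that C(2)
          by (simp add: left_diff_distrib sum_subtractf if_distrib[of "\<lambda>x. x * _"] cong: if_cong)
        finally have "(f i * y None + (\<Sum>j\<in>C. P i j * y (Some j))) / y None \<le> y (Some i) / y None"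
          using pos by (intro divide_right_mono) auto
        then show ?thesis using pos by (simp add: add_divide_distrib sum_divide_distrib)
      qed
      then show ?thesis by (rule that)
    next
      text \<open>Subtracting the largest feasible multiple of the invariant measure \<open>z\<close>, whose cost is
        positive, keeps the total cost nonpositive but loses a state of the support.\<close>
      fix y k
      assume y: "\<And>k. k \<in> J \<Longrightarrow> 0 \<le> y k" and k: "k \<in> {None}" "0 < y k"
        and eq: "\<And>j. j \<in> J \<Longrightarrow> (\<Sum>k\<in>J. y k * a k j) = 0"
      define z where "z i = y (Some i)" for i
      have z_nonneg: "0 \<le> z i" if "i \<in> C" for i using y that by (simp add: J_def z_def)
      have z_cost: "0 < (\<Sum>i\<in>C. z i * f i)"
        using eq[of None] k by (simp add: memJ sumJ a_def z_def sum_negf)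
      have z_inv: "(\<Sum>i\<in>C. z i * P i j) = z j" if "j \<in> C" for j
      proof -
        have "0 = (\<Sum>i\<in>C. z i * ((if i = j then 1 else 0) - P i j))"
          using eq[of "Some j"] that by (simp add: memJ sumJ a_def z_def)
        also have "\<dots> = z j - (\<Sum>i\<in>C. z i * P i j)"
          using that C(2)
          by (simp add: right_diff_distrib sum_subtractf if_distrib[of "\<lambda>x. _ * x"] cong: if_cong)
        finally show ?thesis by simp
      qed
      define Z where "Z = {i\<in>C. 0 < z i}"
      have "Z \<noteq> {}"
      proof
        assume "Z = {}"
        then have "z i = 0" if "i \<in> C" for i using that z_nonneg[OF that] by (auto simp: Z_def)
        then show False using z_cost by simp
      qed
      then have "Min ((\<lambda>i. X i / z i) ` Z) \<in> (\<lambda>i. X i / z i) ` Z"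
        using C(2) by (intro Min_in) (auto simp: Z_def)
      then obtain i0 where i0: "i0 \<in> Z" "Min ((\<lambda>i. X i / z i) ` Z) = X i0 / z i0" by blast
      define \<theta> where "\<theta> = X i0 / z i0"
      have \<theta>: "0 < \<theta>" using i0 C(4)[of i0] by (auto simp: \<theta>_def Z_def)
      have Y_nonneg: "0 \<le> X i - \<theta> * z i" if "i \<in> C" for i
      proof (cases "i \<in> Z")
        case True
        then have "\<theta> \<le> X i / z i"
          unfolding \<theta>_def i0(2)[symmetric] using C(2) by (intro Min_le) (auto simp: Z_def)
        then show ?thesis using True by (simp add: Z_def field_simps)
      next
        case False
        then show ?thesis using that z_nonneg[OF that] C(4)[OF that] by (auto simp: Z_def)
      qed
      \<comment> \<open>The remaining mass is split among controls by \<open>m\<close>, so its flow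
        is again governed by \<open>P\<close>; the difference of two invariant measures is then
        balanced.\<close>
      define x' where "x' i w = (if i \<in> C then (X i - \<theta> * z i) * m i w else 0)" for i w
      have x'_sum: "(\<Sum>w\<in>W i. x' i w * F w) = (if i \<in> C then (X i - \<theta> * z i) * (\<Sum>w\<in>W i. m i w * F w) else 0)"
        for i and F :: "'w \<Rightarrow> real"
        by (simp add: x'_def sum_distrib_left mult.assoc)
      have X'_sum: "(\<Sum>w\<in>W i. x' i w) = (if i \<in> C then X i - \<theta> * z i else 0)" if "i \<in> N" for i
        using x'_sum[of i "\<lambda>_. 1"] m that by (simp add: policy_def)
      have sum_N: "(\<Sum>i\<in>N. if i \<in> C then F i else 0) = (\<Sum>i\<in>C. F i)" for F :: "'s \<Rightarrow> real"
        using C(1) finite_states by (simp add: sum.If_cases Int_absorb1)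
      have cost': "(\<Sum>i\<in>N. \<Sum>w\<in>W i. x' i w * r i w) = (\<Sum>i\<in>C. X i * f i) - \<theta> * (\<Sum>i\<in>C. z i * f i)"
        unfolding x'_sum sum_N
        by (simp add: f_def cost_def left_diff_distrib sum_subtractf sum_distrib_left mult.assoc)
      also have "\<dots> < 0" using sum_Xf z_cost \<theta> by (smt (verit) mult_pos_pos)
      finally have neg: "(\<Sum>i\<in>N. \<Sum>w\<in>W i. x' i w * r i w) < 0" .
      have "occupation x'"
        unfolding occupation_def
      proof (intro conjI ballI)
        show "0 \<le> x' i w" if "i \<in> N" "w \<in> W i" for i w
          using that Y_nonneg m by (auto simp: x'_def policy_def)
      next
        fix j assume j: "j \<in> N"
        have "(\<Sum>i\<in>N. \<Sum>w\<in>W i. x' i w * q i w j) = (\<Sum>i\<in>C. X i * P i j) - \<theta> * (\<Sum>i\<in>C. z i * P i j)"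
          unfolding x'_sum sum_N
          by (simp add: P_def kernel_def left_diff_distrib sum_subtractf sum_distrib_left mult.assoc)
        also have "(\<Sum>i\<in>C. X i * P i j) = X j"
        proof -
          have "(\<Sum>i\<in>C. X i * P i j) = (\<Sum>i\<in>N. X i * P i j)"
            using C(1) finite_states X_zero by (intro sum.mono_neutral_left) auto
          then show ?thesis using invX j by (simp add: P.invariant_def)
        qed
        also have "X j - \<theta> * (\<Sum>i\<in>C. z i * P i j) = (\<Sum>w\<in>W j. x' j w)"
        proof (cases "j \<in> C")
          case True
          then show ?thesis using j by (simp add: X'_sum z_inv)
        next
          case False
          then show ?thesis using j closed X_zero by (simp add: X'_sum)
        qed
        finally show "(\<Sum>i\<in>N. \<Sum>w\<in>W i. x' i w * q i w j) = (\<Sum>w\<in>W j. x' j w)" .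
      next
        \<comment> \<open>Removing positive cost made the total strictly negative, which a vanishing
          measure could not have.\<close>
        show "\<exists>i\<in>N. 0 < (\<Sum>w\<in>W i. x' i w)"
        proof (rule ccontr)
          assume contra: "\<not> ?thesis"
          have "X i - \<theta> * z i = 0" if "i \<in> C" for i
          proof -
            have i: "i \<in> N" using that C(1) by blast
            then have "\<not> 0 < (\<Sum>w\<in>W i. x' i w)" using contra by blast
            then have "\<not> 0 < X i - \<theta> * z i" using that by (simp add: X'_sum[OF i])
            then show ?thesis using Y_nonneg[OF that] by simp
          qed
          then have "x' i w = 0" for i w by (simp add: x'_def)
          then show False using neg by simp
        qed
      qed (use neg in simp)
      moreover have "supp x' \<subset> C"
      proof
        show "supp x' \<subseteq> C" by (auto simp: supp_def X'_sum split: if_splits)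
        have "i0 \<in> C" "X i0 - \<theta> * z i0 = 0" using i0 by (auto simp: \<theta>_def Z_def)
        then have "i0 \<in> C - supp x'" using C(1) by (auto simp: supp_def X'_sum)
        then show "supp x' \<noteq> C" by blast
      qed
      ultimately show ?thesis
        using minimal[of x'] psubset_card_mono[OF C(2), of "supp x'"] unfolding C_def by simp
    qed
  qed

  obtain e where e: "\<And>i. i \<in> N \<Longrightarrow> 0 \<le> e i" "\<And>i. i \<in> N \<Longrightarrow> 1 + (\<Sum>j\<in>N. kernel m0 i j * e j) \<le> e i"
    by (rule P0.expected_time_bound, rule transient) blast+
  define b where "b i = \<bar>f i\<bar> + \<bar>\<Sum>j\<in>C. P i j * h j\<bar>" for i
  \<comment> \<open>\<open>B\<close> dominates the running cost plus the value picked up on entering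
    \<open>C\<close>. Outside \<open>C\<close>, \<open>e\<close> drops by at least 1 per step in
    expectation, so \<open>B * e\<close> pays for \<open>B\<close> in every step.\<close>
  define B where "B = (\<Sum>i\<in>N. b i)"
  have B: "b i \<le> B" if "i \<in> N" for i
    unfolding B_def using that finite_states by (intro member_le_sum) (auto simp: b_def)
  have B_nonneg: "0 \<le> B" by (auto simp: B_def b_def intro!: sum_nonneg)
  define H where "H i = (if i \<in> C then h i else B * e i)" for i
  have "f i + (\<Sum>j\<in>N. P i j * H j) \<le> H i" if i: "i \<in> N" for i
  proof (cases "i \<in> C")
    case True
    then show ?thesis using h[OF True] by (simp add: sumC H_def)
  next
    case False
    have P0: "P i j = kernel m0 i j" for j using False by (simp add: P_def kernel_def m_def)
    have "(\<Sum>j\<in>N. P i j * H j) = (\<Sum>j\<in>N - C. P i j * H j) + (\<Sum>j\<in>C. P i j * H j)"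
      by (rule sum.subset_diff[OF C(1) finite_states])
    also have "(\<Sum>j\<in>C. P i j * H j) = (\<Sum>j\<in>C. P i j * h j)" by (simp add: H_def)
    also have "(\<Sum>j\<in>N - C. P i j * H j) = B * (\<Sum>j\<in>N - C. P i j * e j)"
      by (simp add: H_def sum_distrib_left mult_ac)
    also have "\<dots> \<le> B * (\<Sum>j\<in>N. P i j * e j)"
      using finite_states P.nonneg[OF i] e(1) B_nonneg by (intro mult_left_mono sum_mono2) auto
    also have "\<dots> \<le> B * (e i - 1)"
      using e(2)[OF i] B_nonneg by (intro mult_left_mono) (auto simp: P0)
    finally have "f i + (\<Sum>j\<in>N. P i j * H j) \<le> b i + B * (e i - 1)" by (simp add: b_def)
    also have "\<dots> \<le> B * e i" using B[OF i] by (simp add: algebra_simps)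
    finally show ?thesis using False by (simp add: H_def)
  qed
  note bound = P.total_cost_bounded[of f H, OF this]
  obtain i where i: "i \<in> C" using C(3) by blast
  have "(\<Sum>l\<in>N. chain_power N P k i l) = 1" for k
    using P.invariant_imp_mass_conserved[OF invX _ C(4)[OF i]] i C(1) by blast
  then show ?thesis
    using that[of m i] m i C(1) bound by (auto simp: P_def f_def)
qed

end

section \<open>Weighted sums of bounded martingale differences\<close>

text \<open>\<open>noise_centered\<close> expresses the martingale-difference property by testing
  against bounded \<open>F t\<close>-measurable factors, the form in which cross terms of second
  moments appear.\<close>

locale martingale_noise = prob_space M for M :: "'w measure" +
  fixes F :: "nat \<Rightarrow> 'w measure" and w :: "nat \<Rightarrow> 'w \<Rightarrow> real" and b :: real
  assumes filtration: "filtration (space M) F"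
    and subalgebra: "subalgebra M (F t)"
    and noise_measurable: "w t \<in> borel_measurable (F (Suc t))"
    and noise_bound: "\<omega> \<in> space M \<Longrightarrow> \<bar>w t \<omega>\<bar> \<le> b"
    and noise_centered: "Z \<in> borel_measurable (F t) \<Longrightarrow> (\<And>\<omega>. \<omega> \<in> space M \<Longrightarrow> \<bar>Z \<omega>\<bar> \<le> B) \<Longrightarrow>
        (\<integral>\<omega>. Z \<omega> * w t \<omega> \<partial>M) = 0"
begin

lemma measurable_F_mono: "f \<in> borel_measurable (F s) \<Longrightarrow> s \<le> t \<Longrightarrow> f \<in> borel_measurable (F t)"
  using filtration by (intro measurable_from_subalg[of "F t" "F s"])
    (auto simp: subalgebra_def filtration.space_F dest: filtration.sets_F_mono)

lemma measurable_F_M: "f \<in> borel_measurable (F t) \<Longrightarrow> f \<in> borel_measurable M"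
  by (rule measurable_from_subalg[OF subalgebra])

definition wsum :: "(nat \<Rightarrow> 'w \<Rightarrow> real) \<Rightarrow> nat \<Rightarrow> nat \<Rightarrow> 'w \<Rightarrow> real" where
  "wsum c s t \<omega> = (\<Sum>k\<in>{s..<t}. c k \<omega> * w k \<omega>)"

lemma bounded_imp_integrable:
  fixes f :: "'w \<Rightarrow> real"
  assumes "f \<in> borel_measurable M" "\<And>\<omega>. \<omega> \<in> space M \<Longrightarrow> \<bar>f \<omega>\<bar> \<le> B"
  shows "integrable M f"
  using assms by (intro integrable_const_bound[of _ B]) auto

lemma bounded_square_integrable:
  fixes f :: "'w \<Rightarrow> real"
  assumes [measurable]: "f \<in> borel_measurable M" and B: "\<And>\<omega>. \<omega> \<in> space M \<Longrightarrow> \<bar>f \<omega>\<bar> \<le> B"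
  shows "integrable M (\<lambda>\<omega>. (f \<omega>)\<^sup>2)"
proof (rule bounded_imp_integrable)
  show "\<bar>(f \<omega>)\<^sup>2\<bar> \<le> B\<^sup>2" if "\<omega> \<in> space M" for \<omega>
    using power_mono[OF B[OF that], of 2] by simp
qed measurable

lemma noise_bound_nonneg: "0 \<le> b"
proof -
  obtain \<omega> where "\<omega> \<in> space M" using not_empty by blast
  from noise_bound[OF this, of 0] show ?thesis by simp
qed

lemma wsum_measurable:
  assumes "\<And>k. c k \<in> borel_measurable (F k)"
  shows "wsum c s t \<in> borel_measurable (F t)"
  unfolding wsum_def
proof (intro borel_measurable_sum borel_measurable_times)
  fix k assume "k \<in> {s..<t}"
  then show "c k \<in> borel_measurable (F t)" "w k \<in> borel_measurable (F t)"
    using measurable_F_mono[OF assms, of k t] measurable_F_mono[OF noise_measurable, of k t] by auto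
qed

lemma wsum_bound:
  assumes "\<And>k \<omega>. \<omega> \<in> space M \<Longrightarrow> \<bar>c k \<omega>\<bar> \<le> 1" "\<omega> \<in> space M"
  shows "\<bar>wsum c s t \<omega>\<bar> \<le> real t * b"
proof -
  have "\<bar>wsum c s t \<omega>\<bar> \<le> (\<Sum>k\<in>{s..<t}. 1 * b)"
    unfolding wsum_def using assms noise_bound noise_bound_nonneg
    by (intro order.trans[OF sum_abs] sum_mono) (simp only: abs_mult, intro mult_mono, auto)
  also have "\<dots> \<le> real t * b" using noise_bound_nonneg by (auto intro: mult_right_mono)
  finally show ?thesis .
qed

text \<open>Orthogonality of increments: in the expanded square the cross term is \<open>w t\<close>
  times a bounded factor known at time \<open>t\<close>, so its integral vanishes.\<close>

lemma wsum_second_moment: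
  assumes c: "\<And>k. c k \<in> borel_measurable (F k)" "\<And>k \<omega>. \<omega> \<in> space M \<Longrightarrow> \<bar>c k \<omega>\<bar> \<le> 1"
  shows "(\<integral>\<omega>. (wsum c s t \<omega>)\<^sup>2 \<partial>M) \<le> b\<^sup>2 * (\<Sum>k\<in>{s..<t}. \<integral>\<omega>. (c k \<omega>)\<^sup>2 \<partial>M)"
proof (induction t)
  case 0
  then show ?case by (simp add: wsum_def)
next
  case (Suc t)
  show ?case
  proof (cases "s \<le> t")
    case False
    then show ?thesis by (simp add: wsum_def)
  next
    case True
    have meas[measurable]: "wsum c s t \<in> borel_measurable M" "c t \<in> borel_measurable M" "w t \<in> borel_measurable M"
      using measurable_F_M wsum_measurable[OF c(1)] c(1) noise_measurable by blast+
    have cw: "\<bar>c t \<omega> * w t \<omega>\<bar> \<le> b" if "\<omega> \<in> space M" for \<omega>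
      using mult_mono[OF c(2)[OF that] noise_bound[OF that]] by (simp add: abs_mult)
    have int: "integrable M (\<lambda>\<omega>. (wsum c s t \<omega>)\<^sup>2)" "integrable M (\<lambda>\<omega>. (c t \<omega> * w t \<omega>)\<^sup>2)"
        "integrable M (\<lambda>\<omega>. (c t \<omega>)\<^sup>2)"
      using bounded_square_integrable[OF meas(1) wsum_bound[OF c(2)]]
        bounded_square_integrable[OF borel_measurable_times[OF meas(2,3)] cw]
        bounded_square_integrable[OF meas(2) c(2)] by blast+
    have "(\<lambda>\<omega>. 2 * wsum c s t \<omega> * c t \<omega>) \<in> borel_measurable (F t)"
      by (intro borel_measurable_times borel_measurable_const wsum_measurable c(1))
    moreover have zb: "\<bar>2 * wsum c s t \<omega> * c t \<omega>\<bar> \<le> 2 * (real t * b) * 1" if "\<omega> \<in> space M" for \<omega>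
      unfolding abs_mult using c(2)[OF that] wsum_bound[OF c(2) that] noise_bound_nonneg
      by (intro mult_mono) auto
    ultimately have orth: "(\<integral>\<omega>. (2 * wsum c s t \<omega> * c t \<omega>) * w t \<omega> \<partial>M) = 0"
      by (rule noise_centered)
    have "\<bar>(2 * wsum c s t \<omega> * c t \<omega>) * w t \<omega>\<bar> \<le> 2 * (real t * b) * 1 * b" if "\<omega> \<in> space M" for \<omega>
      unfolding abs_mult[of _ "w t \<omega>"] using zb[OF that] noise_bound[OF that] noise_bound_nonneg
      by (intro mult_mono) auto
    then have int': "integrable M (\<lambda>\<omega>. (2 * wsum c s t \<omega> * c t \<omega>) * w t \<omega>)"
      by (intro bounded_imp_integrable) auto
    have "(wsum c s (Suc t) \<omega>)\<^sup>2 = (wsum c s t \<omega>)\<^sup>2 + (2 * wsum c s t \<omega> * c t \<omega>) * w t \<omega> + (c t \<omega> * w t \<omega>)\<^sup>2" for \<omega>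
      using True by (simp add: wsum_def power2_eq_square algebra_simps)
    then have "(\<integral>\<omega>. (wsum c s (Suc t) \<omega>)\<^sup>2 \<partial>M) = (\<integral>\<omega>. (wsum c s t \<omega>)\<^sup>2 \<partial>M) + (\<integral>\<omega>. (c t \<omega> * w t \<omega>)\<^sup>2 \<partial>M)"
      using int int' orth by simp
    also have "(\<integral>\<omega>. (c t \<omega> * w t \<omega>)\<^sup>2 \<partial>M) \<le> (\<integral>\<omega>. (c t \<omega>)\<^sup>2 * b\<^sup>2 \<partial>M)"
      using int noise_bound noise_bound_nonneg
      by (intro integral_mono) (auto simp: power_mult_distrib intro!: mult_left_mono abs_le_square_iff[THEN iffD1])
    finally show ?thesis using Suc True by (simp add: algebra_simps)
  qed
qed

text \<open>Kolmogorov's maximal inequality: stopping the sum at its first exit from \<open>[-x, x]\<close>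
  only switches off weights, so the second-moment bound still applies.\<close>

lemma wsum_maximal_inequality:
  assumes c: "\<And>k. c k \<in> borel_measurable (F k)" "\<And>k \<omega>. \<omega> \<in> space M \<Longrightarrow> \<bar>c k \<omega>\<bar> \<le> 1" and x: "0 < x"
  shows "prob {\<omega> \<in> space M. \<exists>u\<in>{s..t}. x < \<bar>wsum c s u \<omega>\<bar>} \<le> b\<^sup>2 / x\<^sup>2 * (\<Sum>k\<in>{s..<t}. \<integral>\<omega>. (c k \<omega>)\<^sup>2 \<partial>M)"
proof -
  \<comment> \<open>The test may include \<open>u = k\<close>, since \<open>wsum c s k\<close>
    involves only noise before index \<open>k\<close>; the switched weight is still known at time
    \<open>k\<close>.\<close>
  define c' where "c' k \<omega> = (if \<exists>u\<in>{s..k}. x < \<bar>wsum c s u \<omega>\<bar> then 0 else c k \<omega>)" for k \<omega>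
  have c'_meas: "c' k \<in> borel_measurable (F k)" for k
  proof -
    have wsum: "wsum c s u \<in> borel_measurable (F k)" if "u \<in> {s..k}" for u
      using measurable_F_mono[OF wsum_measurable[OF c(1)]] that by auto
    have [measurable]: "c k \<in> borel_measurable (F k)" by (rule c)
    have "{\<omega> \<in> space (F k). \<exists>u\<in>{s..k}. x < \<bar>wsum c s u \<omega>\<bar>} = (\<Union>u\<in>{s..k}. {\<omega> \<in> space (F k). x < \<bar>wsum c s u \<omega>\<bar>})"
      by auto
    also have "\<dots> \<in> sets (F k)"
      by (intro sets.finite_UN borel_measurable_less borel_measurable_abs measurable_const wsum) auto
    finally show ?thesis unfolding c'_def by (intro measurable_If) auto
  qed
  have c'_le: "\<bar>c' k \<omega>\<bar> \<le> \<bar>c k \<omega>\<bar>" for k \<omega> by (simp add: c'_def)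
  then have c'_1: "\<bar>c' k \<omega>\<bar> \<le> 1" if "\<omega> \<in> space M" for k \<omega> using c(2)[OF that] order.trans by blast
  \<comment> \<open>From the first exit time \<open>v\<close> on all weights are zero, so the
    stopped sum is frozen at its value at \<open>v\<close>, outside the interval.\<close>
  have exit: "x < \<bar>wsum c' s t \<omega>\<bar>" if "u \<in> {s..t}" "x < \<bar>wsum c s u \<omega>\<bar>" for u \<omega>
  proof -
    define v where "v = (LEAST v. s \<le> v \<and> x < \<bar>wsum c s v \<omega>\<bar>)"
    have v: "s \<le> v \<and> x < \<bar>wsum c s v \<omega>\<bar>" unfolding v_def by (rule LeastI[of _ u]) (use that in auto)
    have "v \<le> u" unfolding v_def by (rule Least_le) (use that in auto)
    have before: "\<not> x < \<bar>wsum c s k \<omega>\<bar>" if "s \<le> k" "k < v" for k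
      using not_less_Least[of k "\<lambda>v. s \<le> v \<and> x < \<bar>wsum c s v \<omega>\<bar>"] that unfolding v_def by blast
    have split: "{s..<t} = {s..<v} \<union> {v..<t}" using v \<open>v \<le> u\<close> that by auto
    have "wsum c' s t \<omega> = (\<Sum>k\<in>{s..<v}. c' k \<omega> * w k \<omega>) + (\<Sum>k\<in>{v..<t}. c' k \<omega> * w k \<omega>)"
      unfolding wsum_def split by (rule sum.union_disjoint) auto
    also have "(\<Sum>k\<in>{v..<t}. c' k \<omega> * w k \<omega>) = 0"
      by (intro sum.neutral ballI) (use v in \<open>auto simp: c'_def\<close>)
    also have "(\<Sum>k\<in>{s..<v}. c' k \<omega> * w k \<omega>) = wsum c s v \<omega>"
      unfolding wsum_def using before by (intro sum.cong) (auto simp: c'_def)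
    finally show ?thesis using v by simp
  qed
  have [measurable]: "wsum c' s t \<in> borel_measurable M" "\<And>k. c' k \<in> borel_measurable M" "\<And>k. c k \<in> borel_measurable M"
    using measurable_F_M[OF wsum_measurable[OF c'_meas]] measurable_F_M[OF c'_meas] measurable_F_M[OF c(1)] by auto
  have int: "integrable M (\<lambda>\<omega>. (wsum c' s t \<omega>)\<^sup>2)"
    by (rule bounded_square_integrable) (use wsum_bound[OF c'_1] in auto)
  have sq_int: "integrable M (\<lambda>\<omega>. (d k \<omega>)\<^sup>2)"
    if [measurable]: "d k \<in> borel_measurable M" and "\<And>\<omega>. \<omega> \<in> space M \<Longrightarrow> \<bar>d k \<omega>\<bar> \<le> 1" for d :: "nat \<Rightarrow> 'w \<Rightarrow> real" and k
    by (rule bounded_square_integrable[OF that])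
  have "prob {\<omega> \<in> space M. \<exists>u\<in>{s..t}. x < \<bar>wsum c s u \<omega>\<bar>} \<le> prob {\<omega> \<in> space M. x\<^sup>2 \<le> (wsum c' s t \<omega>)\<^sup>2}"
  proof (intro finite_measure_mono subsetI)
    fix \<omega> assume "\<omega> \<in> {\<omega> \<in> space M. \<exists>u\<in>{s..t}. x < \<bar>wsum c s u \<omega>\<bar>}"
    then show "\<omega> \<in> {\<omega> \<in> space M. x\<^sup>2 \<le> (wsum c' s t \<omega>)\<^sup>2}"
      using exit x by (auto simp flip: abs_le_square_iff intro!: less_imp_le)
  qed measurable
  also have "\<dots> \<le> (\<integral>\<omega>. (wsum c' s t \<omega>)\<^sup>2 \<partial>M) / x\<^sup>2"
    using x by (intro integral_Markov_inequality_measure[OF int sets.top]) auto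
  also have "\<dots> \<le> (b\<^sup>2 * (\<Sum>k\<in>{s..<t}. \<integral>\<omega>. (c' k \<omega>)\<^sup>2 \<partial>M)) / x\<^sup>2"
    by (intro divide_right_mono wsum_second_moment c'_meas c'_1) auto
  also have "\<dots> \<le> (b\<^sup>2 * (\<Sum>k\<in>{s..<t}. \<integral>\<omega>. (c k \<omega>)\<^sup>2 \<partial>M)) / x\<^sup>2"
    using c'_1 c(2) c'_le
    by (intro divide_right_mono mult_left_mono sum_mono integral_mono sq_int) (auto simp flip: abs_le_square_iff)
  finally show ?thesis by simp
qed

text \<open>A deterministic bound on the square sums makes the expected squares summable. The
  maximal inequality then bounds the probability of a large excursion after time \<open>s\<close> by
  a tail of that series.\<close>

lemma wsum_tail_small:
  assumes c: "\<And>k. c k \<in> borel_measurable (F k)" "\<And>k \<omega>. \<omega> \<in> space M \<Longrightarrow> \<bar>c k \<omega>\<bar> \<le> 1"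
    and sq: "\<And>t \<omega>. \<omega> \<in> space M \<Longrightarrow> (\<Sum>k<t. (c k \<omega>)\<^sup>2) \<le> K" and x: "0 < x"
  shows "AE \<omega> in M. \<exists>s. \<forall>t\<ge>s. \<bar>wsum c s t \<omega>\<bar> \<le> x"
proof -
  define a where "a k = (\<integral>\<omega>. (c k \<omega>)\<^sup>2 \<partial>M)" for k
  have [measurable]: "c k \<in> borel_measurable M" "wsum c s t \<in> borel_measurable M" for k s t
    using measurable_F_M[OF wsum_measurable[OF c(1)]] measurable_F_M[OF c(1)] by auto
  have int: "integrable M (\<lambda>\<omega>. (c k \<omega>)\<^sup>2)" for k
    by (rule bounded_square_integrable[OF _ c(2)]) measurable
  have a_nonneg: "0 \<le> a k" for k by (simp add: a_def)
  have "(\<Sum>k<t. a k) \<le> K" for t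
  proof -
    have "(\<Sum>k<t. a k) = (\<integral>\<omega>. (\<Sum>k<t. (c k \<omega>)\<^sup>2) \<partial>M)" using int by (simp add: a_def)
    also have "\<dots> \<le> (\<integral>\<omega>. K \<partial>M)" using int sq by (intro integral_mono) auto
    finally show ?thesis by (simp add: prob_space)
  qed
  then have summ: "summable a" using a_nonneg by (intro summableI_nonneg_bounded)
  define E where "E s = {\<omega> \<in> space M. \<exists>t\<ge>s. x < \<bar>wsum c s t \<omega>\<bar>}" for s
  have [measurable]: "E s \<in> sets M" for s unfolding E_def by measurable
  have tail: "prob (E s) \<le> b\<^sup>2 / x\<^sup>2 * (\<Sum>k. a (k + s))" for s
  proof -
    define D where "D t = {\<omega> \<in> space M. \<exists>u\<in>{s..t}. x < \<bar>wsum c s u \<omega>\<bar>}" for t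
    have [measurable]: "D t \<in> sets M" for t unfolding D_def by measurable
    have "(\<Union>t. D t) = E s" by (force simp: D_def E_def)
    moreover have "incseq D" by (fastforce simp: D_def incseq_def)
    ultimately have lim: "(\<lambda>t. prob (D t)) \<longlonglongrightarrow> prob (E s)"
      using finite_Lim_measure_incseq[of D] by (simp add: image_subset_iff)
    have "prob (D t) \<le> b\<^sup>2 / x\<^sup>2 * (\<Sum>k. a (k + s))" for t
    proof -
      have "(\<Sum>k\<in>{s..<t}. a k) = (\<Sum>k<t - s. a (k + s))"
        by (cases "s \<le> t") (use sum.shift_bounds_nat_ivl[of a 0 s "t - s"] in \<open>auto simp: lessThan_atLeast0\<close>)
      also have "\<dots> \<le> (\<Sum>k. a (k + s))"
        using summ a_nonneg by (intro sum_le_suminf) (auto simp: summable_iff_shift)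
      finally have "b\<^sup>2 / x\<^sup>2 * (\<Sum>k\<in>{s..<t}. a k) \<le> b\<^sup>2 / x\<^sup>2 * (\<Sum>k. a (k + s))"
        by (intro mult_left_mono) auto
      then show ?thesis
        using wsum_maximal_inequality[OF c x, of s t] unfolding D_def a_def by linarith
    qed
    then show ?thesis using lim by (intro LIMSEQ_le_const2) auto
  qed
  have "(\<lambda>s. b\<^sup>2 / x\<^sup>2 * (\<Sum>k. a (k + s))) \<longlonglongrightarrow> b\<^sup>2 / x\<^sup>2 * 0"
    by (intro tendsto_mult_left suminf_exist_split2 summ)
  moreover have "prob (\<Inter>s. E s) \<le> b\<^sup>2 / x\<^sup>2 * (\<Sum>k. a (k + s))" for s
    by (rule order.trans[OF finite_measure_mono tail]) auto
  \<comment> \<open>The exceptional event is an excursion after every \<open>s\<close>; it lies in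
    each \<open>E s\<close>, whose probability bound tends to 0.\<close>
  ultimately have "prob (\<Inter>s. E s) \<le> 0" by (intro LIMSEQ_le_const) auto
  then have "(\<Inter>s. E s) \<in> null_sets M"
    by (intro null_setsI) (auto simp: emeasure_eq_measure measure_le_0_iff)
  then show ?thesis by (rule AE_I') (force simp: E_def not_le)
qed

text \<open>Localisation: \<open>d K\<close> drops a weight once the running square sum, the current
  term included, exceeds \<open>K\<close>. This keeps the truncated square sums below
  \<open>K\<close>, and a path with summable squares is left unchanged by some \<open>K\<close>, so
  countably many null sets suffice.\<close>

lemma square_summable_wsum_tail_small:
  assumes c: "\<And>k. c k \<in> borel_measurable (F k)" "\<And>k \<omega>. \<omega> \<in> space M \<Longrightarrow> \<bar>c k \<omega>\<bar> \<le> 1"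
    and sq: "AE \<omega> in M. summable (\<lambda>k. (c k \<omega>)\<^sup>2)" and x: "0 < x"
  shows "AE \<omega> in M. \<exists>s. \<forall>t\<ge>s. \<bar>\<Sum>k\<in>{s..<t}. c k \<omega> * w k \<omega>\<bar> \<le> x"
proof -
  define d where "d K k \<omega> = (if (\<Sum>i\<le>k. (c i \<omega>)\<^sup>2) \<le> real K then c k \<omega> else 0)" for K k \<omega>
  have "AE \<omega> in M. \<exists>s. \<forall>t\<ge>s. \<bar>wsum (d K) s t \<omega>\<bar> \<le> x" for K
  proof (rule wsum_tail_small[OF _ _ _ x])
    fix k
    have [measurable]: "c k \<in> borel_measurable (F k)" by (rule c)
    have [measurable]: "(\<lambda>\<omega>. \<Sum>i\<le>k. (c i \<omega>)\<^sup>2) \<in> borel_measurable (F k)"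
      by (intro borel_measurable_sum borel_measurable_power)
        (use measurable_F_mono[OF c(1)] in auto)
    show "d K k \<in> borel_measurable (F k)" unfolding d_def by measurable
  next
    show "\<bar>d K k \<omega>\<bar> \<le> 1" if "\<omega> \<in> space M" for k \<omega> using c(2)[OF that] by (simp add: d_def)
  next
    fix t \<omega>
    show "(\<Sum>k<t. (d K k \<omega>)\<^sup>2) \<le> real K"
    proof (induction t)
      case (Suc t)
      show ?case
      proof (cases "(\<Sum>i\<le>t. (c i \<omega>)\<^sup>2) \<le> real K")
        case True
        have "(\<Sum>k<Suc t. (d K k \<omega>)\<^sup>2) \<le> (\<Sum>k<Suc t. (c k \<omega>)\<^sup>2)" by (intro sum_mono) (simp add: d_def)
        then show ?thesis using True by (simp add: lessThan_Suc_atMost)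
      next
        case False
        then show ?thesis using Suc by (simp add: d_def)
      qed
    qed simp
  qed
  then have "AE \<omega> in M. \<forall>K. \<exists>s. \<forall>t\<ge>s. \<bar>wsum (d K) s t \<omega>\<bar> \<le> x" by (simp add: AE_all_countable)
  with sq show ?thesis
  proof eventually_elim
    case (elim \<omega>)
    obtain K :: nat where K: "(\<Sum>k. (c k \<omega>)\<^sup>2) \<le> real K" using real_arch_simple by blast
    have "(\<Sum>i\<le>k. (c i \<omega>)\<^sup>2) \<le> real K" for k
      using sum_le_suminf[OF elim(1), of "{..k}"] K by simp
    then have "wsum (d K) s t \<omega> = (\<Sum>k\<in>{s..<t}. c k \<omega> * w k \<omega>)" for s t by (simp add: wsum_def d_def)
    then show ?case using elim(2) by metis
  qed
qed

end

section \<open>Potentials of the game\<close>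

text \<open>The hypothesis \<open>unbounded\<close> is the shape in which the third model assumption
  enters; it refutes the occupation alternative, while the terminating \<open>m0\<close> excludes
  invariant measures outside the support.\<close>

lemma (in controlled_chain) subsolution_exists:
  assumes m0: "policy m0" and terminating: "\<And>i. i \<in> N \<Longrightarrow> \<exists>k. (\<Sum>l\<in>N. chain_power N (kernel m0) k i l) \<noteq> 1"
    and unbounded: "\<And>m i B. policy m \<Longrightarrow> i \<in> N \<Longrightarrow> (\<And>k. (\<Sum>l\<in>N. chain_power N (kernel m) k i l) = 1) \<Longrightarrow>
      (\<And>i t. i \<in> N \<Longrightarrow> (\<Sum>k\<le>t. \<Sum>l\<in>N. chain_power N (kernel m) k i l * cost m l) \<le> B) \<Longrightarrow> False"
  obtains L d where "0 < d" "\<And>i w. i \<in> N \<Longrightarrow> w \<in> W i \<Longrightarrow> L i + d \<le> r i w + (\<Sum>j\<in>N. q i w j * L j)"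
proof (rule subsolution_or_occupation)
  interpret S: substochastic N "kernel m0" by (rule substochastic_kernel[OF m0])
  fix x assume x: "occupation x"
  have "z i = 0" if z: "S.invariant z" and i: "i \<in> N" for z i
  proof (rule ccontr)
    assume "z i \<noteq> 0"
    then have "0 < z i" using z i by (force simp: S.invariant_def)
    then show False using S.invariant_imp_mass_conserved[OF z i] terminating[OF i] by blast
  qed
  then show thesis
  proof (rule occupation_imp_bounded_policy[OF x m0])
    fix m i B
    assume "policy m" "i \<in> N" "\<And>k. (\<Sum>l\<in>N. chain_power N (kernel m) k i l) = 1"
      "\<And>i t. i \<in> N \<Longrightarrow> (\<Sum>k\<le>t. \<Sum>l\<in>N. chain_power N (kernel m) k i l * cost m l) \<le> B"
    then have False by (rule unbounded)
    then show thesis ..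
  qed
qed (rule that)

section \<open>Translating between weights and kernels and the policies of the game\<close>

lemma chain_power_cong:
  assumes "\<And>i j. i \<in> N \<Longrightarrow> j \<in> N \<Longrightarrow> P i j = P' i j" "l \<in> N"
  shows "chain_power N P k i l = chain_power N P' k i l"
  using assms(2) by (induction k arbitrary: l) (auto intro!: sum.cong simp: assms(1))

lemma kstep_eq_chain_power:
  "kstep n U V p \<mu> \<nu> k i l = chain_power (states n) (Ptrans U V p \<mu> \<nu>) k i l"
  by (induction k arbitrary: l) simp_all

lemma prolonging_if_mass_conserved:
  assumes "i \<in> states n" "\<And>k. (\<Sum>l\<in>states n. kstep n U V p \<mu> \<nu> k i l) = 1"
  shows "prolonging n U V p \<mu> \<nu>"
  using assms unfolding prolonging_def by (intro bexI[of _ i]) auto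

lemma finite_states_set: "finite (states n)"
  by (simp add: states_def)

lemma pmf_of_finite_weights:
  assumes "finite A" "\<And>w. w \<in> A \<Longrightarrow> 0 \<le> f w" "(\<Sum>w\<in>A. f w) = 1"
  obtains q where "set_pmf q \<subseteq> A" "\<And>w. w \<in> A \<Longrightarrow> pmf q w = f w"
proof -
  define q where "q = embed_pmf (\<lambda>w. if w \<in> A then f w else 0)"
  have "(\<integral>\<^sup>+ w. ennreal (if w \<in> A then f w else 0) \<partial>count_space UNIV)
      = (\<Sum>w\<in>A. ennreal (if w \<in> A then f w else 0))"
    using assms(1) by (intro nn_integral_count_space') auto
  also have "\<dots> = ennreal (\<Sum>w\<in>A. f w)" using assms(2) by (simp add: sum_ennreal)
  finally have "pmf q w = (if w \<in> A then f w else 0)" for w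
    unfolding q_def using assms by (intro pmf_embed_pmf) auto
  then show ?thesis by (intro that[of q]) (auto simp: set_pmf_eq)
qed

lemma pmf_policy_exists:
  assumes "\<And>i. i \<in> N \<Longrightarrow> finite (A i)" "\<And>i w. i \<in> N \<Longrightarrow> w \<in> A i \<Longrightarrow> 0 \<le> m i w"
    "\<And>i. i \<in> N \<Longrightarrow> (\<Sum>w\<in>A i. m i w) = 1"
  obtains \<mu> where "\<And>i. i \<in> N \<Longrightarrow> set_pmf (\<mu> i) \<subseteq> A i"
    "\<And>i w. i \<in> N \<Longrightarrow> w \<in> A i \<Longrightarrow> m i w = pmf (\<mu> i) w"
proof -
  have "\<exists>q. set_pmf q \<subseteq> A i \<and> (\<forall>w\<in>A i. m i w = pmf q w)" if "i \<in> N" for i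
    by (rule pmf_of_finite_weights[of "A i" "m i"]) (use assms that in auto)
  then have "\<forall>i\<in>N. \<exists>q. set_pmf q \<subseteq> A i \<and> (\<forall>w\<in>A i. m i w = pmf q w)" by blast
  from bchoice[OF this] show ?thesis using that by blast
qed

locale game_model =
  fixes n :: nat and U :: "nat \<Rightarrow> 'u set" and V :: "nat \<Rightarrow> 'v set"
    and p g :: "nat \<Rightarrow> 'u \<Rightarrow> 'v \<Rightarrow> nat \<Rightarrow> real"
  assumes game: "ssp_game n U V p" and model: "SSP_model_assumption n U V p g"
begin

lemma finite_controls:
  assumes "i \<in> states n" shows "finite (U i)" "finite (V i)"
  using game assms by (auto simp: ssp_game_def)

lemma trans_prob:
  assumes "i \<in> states n" "u \<in> U i" "v \<in> V i"
  shows "j \<in> {0..n} \<Longrightarrow> 0 \<le> p i u v j" "(\<Sum>j\<in>{0..n}. p i u v j) = 1"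
  using game assms by (auto simp: ssp_game_def)

lemma sum_states_0: "(\<Sum>j\<in>{0..n}. f j) = f 0 + (\<Sum>j\<in>states n. f j)" for f :: "nat \<Rightarrow> real"
  unfolding states_def by (simp add: sum.atLeast_Suc_atMost)

lemma trans_states_le_1:
  assumes "i \<in> states n" "u \<in> U i" "v \<in> V i"
  shows "(\<Sum>j\<in>states n. p i u v j) \<le> 1"
  using trans_prob(1)[OF assms, of 0] trans_prob(2)[OF assms] by (simp add: sum_states_0)

lemma SR_pmf_sum:
  assumes "i \<in> states n"
  shows "\<mu> \<in> SR_policies n U \<Longrightarrow> (\<Sum>u\<in>U i. pmf (\<mu> i) u) = 1"
    and "\<nu> \<in> SR_policies n V \<Longrightarrow> (\<Sum>v\<in>V i. pmf (\<nu> i) v) = 1"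
  using assms finite_controls[OF assms] by (auto simp: SR_policies_def intro!: sum_pmf_eq_1)

lemma Jcost_less_infinity:
  assumes "\<And>t. (\<Sum>k\<le>t. \<Sum>l\<in>states n. kstep n U V p \<mu> \<nu> k i l * stage_cost n U V p g \<mu> \<nu> l) \<le> B"
  shows "Jcost n U V p g \<mu> \<nu> i < \<infinity>"
proof -
  have "Jcost n U V p g \<mu> \<nu> i \<le> limsup (\<lambda>t. ereal (\<Sum>k\<le>t. \<Sum>l\<in>states n. kstep n U V p \<mu> \<nu> k i l * stage_cost n U V p g \<mu> \<nu> l))"
    unfolding Jcost_def by (intro Liminf_le_Limsup) simp
  also have "\<dots> \<le> ereal B" by (intro Limsup_bounded) (simp add: assms)
  finally show ?thesis by auto
qed

lemma Jcost_greater_minus_infinity: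
  assumes "\<And>t. B \<le> (\<Sum>k\<le>t. \<Sum>l\<in>states n. kstep n U V p \<mu> \<nu> k i l * stage_cost n U V p g \<mu> \<nu> l)"
  shows "- \<infinity> < Jcost n U V p g \<mu> \<nu> i"
proof -
  have "ereal B \<le> Jcost n U V p g \<mu> \<nu> i"
    unfolding Jcost_def by (intro Liminf_bounded) (simp add: assms)
  then show ?thesis by (metis MInfty_neq_ereal(1) ereal_infty_less(2) ereal_infty_less_eq(2))
qed

lemma not_prolonging_if_finite:
  assumes "\<mu> \<in> SR_policies n U" "\<nu> \<in> SR_policies n V"
    "\<And>i. i \<in> states n \<Longrightarrow> Jcost n U V p g \<mu> \<nu> i < \<infinity>" "\<And>i. i \<in> states n \<Longrightarrow> - \<infinity> < Jcost n U V p g \<mu> \<nu> i"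
  shows "\<not> prolonging n U V p \<mu> \<nu>"
  using model assms unfolding SSP_model_assumption_def by fastforce

text \<open>Against each other, the two security policies have a cost that is infinite in neither
  direction at any state, so they cannot be prolonging. Each thus serves as the terminating reply to
  the other.\<close>

lemma security_policies:
  obtains \<mu> \<nu> where "\<mu> \<in> SR_policies n U" "\<nu> \<in> SR_policies n V"
    "\<And>\<nu>' i. \<nu>' \<in> SR_policies n V \<Longrightarrow> i \<in> states n \<Longrightarrow> Jcost n U V p g \<mu> \<nu>' i < \<infinity>"
    "\<And>\<mu>' i. \<mu>' \<in> SR_policies n U \<Longrightarrow> i \<in> states n \<Longrightarrow> - \<infinity> < Jcost n U V p g \<mu>' \<nu> i"
    "\<And>i. i \<in> states n \<Longrightarrow> \<exists>k. (\<Sum>l\<in>states n. kstep n U V p \<mu> \<nu> k i l) \<noteq> 1"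
proof -
  obtain \<mu> where \<mu>: "\<mu> \<in> SR_policies n U"
    "\<And>\<nu> i. \<nu> \<in> SR_policies n V \<Longrightarrow> i \<in> states n \<Longrightarrow> Jcost n U V p g \<mu> \<nu> i < \<infinity>"
    using model by (auto simp: SSP_model_assumption_def)
  obtain \<nu> where \<nu>: "\<nu> \<in> SR_policies n V"
    "\<And>\<mu> i. \<mu> \<in> SR_policies n U \<Longrightarrow> i \<in> states n \<Longrightarrow> - \<infinity> < Jcost n U V p g \<mu> \<nu> i"
    using model by (auto simp: SSP_model_assumption_def)
  have "\<not> prolonging n U V p \<mu> \<nu>" using \<mu> \<nu> by (intro not_prolonging_if_finite)
  then show ?thesis using that \<mu> \<nu> prolonging_if_mass_conserved by blast
qed

lemma expected_cost_plus_potential: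
  fixes c :: "'w \<Rightarrow> real"
  assumes "L 0 = 0"
  shows "(\<Sum>w\<in>A. c w * (\<Sum>j\<in>{0..n}. P w j * (G w j + L j)))
    = (\<Sum>w\<in>A. c w * (\<Sum>j\<in>{0..n}. P w j * G w j)) + (\<Sum>j\<in>states n. (\<Sum>w\<in>A. c w * P w j) * L j)"
proof -
  have "(\<Sum>j\<in>states n. (\<Sum>w\<in>A. c w * P w j) * L j) = (\<Sum>j\<in>states n. \<Sum>w\<in>A. c w * (P w j * L j))"
    by (simp add: sum_distrib_right mult.assoc)
  also have "\<dots> = (\<Sum>w\<in>A. \<Sum>j\<in>states n. c w * (P w j * L j))" by (rule sum.swap)
  finally show ?thesis
    using assms by (simp add: distrib_left sum.distrib sum_states_0 sum_distrib_left)
qed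

text \<open>Player II is frozen at the security policy and player I minimises. A prolonging reply
  with partial costs bounded above would have cost below \<open>\<infinity>\<close> everywhere,
  while \<open>\<nu>\<close> keeps it above \<open>- \<infinity>\<close>, against the third model
  assumption.\<close>

lemma lower_potential:
  obtains \<nu> L d where "\<nu> \<in> SR_policies n V" "L 0 = 0" "0 < d"
    "\<And>i u. i \<in> states n \<Longrightarrow> u \<in> U i \<Longrightarrow>
      L i + d \<le> (\<Sum>v\<in>V i. pmf (\<nu> i) v * (\<Sum>j\<in>{0..n}. p i u v j * (g i u v j + L j)))"
proof -
  obtain \<mu> \<nu> where \<mu>: "\<mu> \<in> SR_policies n U" and \<nu>: "\<nu> \<in> SR_policies n V"
    and J: "\<And>\<mu>' i. \<mu>' \<in> SR_policies n U \<Longrightarrow> i \<in> states n \<Longrightarrow> - \<infinity> < Jcost n U V p g \<mu>' \<nu> i"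
    and terminating: "\<And>i. i \<in> states n \<Longrightarrow> \<exists>k. (\<Sum>l\<in>states n. kstep n U V p \<mu> \<nu> k i l) \<noteq> 1"
    by (rule security_policies) blast
  define q where "q i u j = (\<Sum>v\<in>V i. pmf (\<nu> i) v * p i u v j)" for i u j
  define r where "r i u = (\<Sum>v\<in>V i. pmf (\<nu> i) v * (\<Sum>j\<in>{0..n}. p i u v j * g i u v j))" for i u
  interpret controlled_chain "states n" U q r
  proof
    fix i u assume iu: "i \<in> states n" "u \<in> U i"
    have "(\<Sum>j\<in>states n. q i u j) = (\<Sum>v\<in>V i. pmf (\<nu> i) v * (\<Sum>j\<in>states n. p i u v j))"
      unfolding q_def by (subst sum.swap) (simp add: sum_distrib_left)
    also have "\<dots> \<le> (\<Sum>v\<in>V i. pmf (\<nu> i) v * 1)"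
      using iu by (intro sum_mono mult_left_mono trans_states_le_1) auto
    finally show "(\<Sum>j\<in>states n. q i u j) \<le> 1" using SR_pmf_sum(2)[OF iu(1) \<nu>(1)] by simp
  qed (auto simp: q_def finite_states_set finite_controls states_def trans_prob intro!: sum_nonneg)
  have kernel: "kernel m i j = Ptrans U V p \<mu>' \<nu> i j"
    and cost: "cost m i = stage_cost n U V p g \<mu>' \<nu> i"
    if "\<And>u. u \<in> U i \<Longrightarrow> m i u = pmf (\<mu>' i) u" for m \<mu>' i j
    using that by (auto simp: kernel_def cost_def Ptrans_def stage_cost_def q_def r_def sum_distrib_left mult.assoc
        intro!: sum.cong)
  have power: "chain_power (states n) (kernel m) k i l = kstep n U V p \<mu>' \<nu> k i l"
    if "\<And>i u. i \<in> states n \<Longrightarrow> u \<in> U i \<Longrightarrow> m i u = pmf (\<mu>' i) u" "l \<in> states n" for m \<mu>' k i l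
    unfolding kstep_eq_chain_power by (intro chain_power_cong that(2) kernel that(1))
  show ?thesis
  proof (rule subsolution_exists[of "\<lambda>i. pmf (\<mu> i)"])
    show "policy (\<lambda>i. pmf (\<mu> i))" using SR_pmf_sum(1)[OF _ \<mu>] by (simp add: policy_def)
    show "\<exists>k. (\<Sum>l\<in>states n. chain_power (states n) (kernel (\<lambda>i. pmf (\<mu> i))) k i l) \<noteq> 1" if "i \<in> states n" for i
      using terminating[OF that] by (simp add: power)
  next
    fix L d assume L: "0 < d" "\<And>i u. i \<in> states n \<Longrightarrow> u \<in> U i \<Longrightarrow> L i + d \<le> r i u + (\<Sum>j\<in>states n. q i u j * L j)"
    \<comment> \<open>The subsolution says nothing about state 0; the value 0 there matches the
      terminal Q-factor.\<close>
    define L' where "L' j = (if j = 0 then 0 else L j)" for j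
    have L'0: "L' 0 = 0" by (simp add: L'_def)
    have L'_states: "L' i = L i" if "i \<in> states n" for i using that by (simp add: L'_def states_def)
    have "L' i + d \<le> (\<Sum>v\<in>V i. pmf (\<nu> i) v * (\<Sum>j\<in>{0..n}. p i u v j * (g i u v j + L' j)))"
      if "i \<in> states n" "u \<in> U i" for i u
      unfolding expected_cost_plus_potential[of L', OF L'0] using L(2)[OF that] that
      by (simp add: L'_states r_def flip: q_def)
    then show ?thesis using that[of \<nu> L' d] \<nu> L(1) L'0 by blast
  next
    fix m i B
    assume m: "policy m" and i: "i \<in> states n"
      and mass: "\<And>k. (\<Sum>l\<in>states n. chain_power (states n) (kernel m) k i l) = 1"
      and bound: "\<And>i t. i \<in> states n \<Longrightarrow> (\<Sum>k\<le>t. \<Sum>l\<in>states n. chain_power (states n) (kernel m) k i l * cost m l) \<le> B"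
    obtain \<mu>' where \<mu>': "\<And>i. i \<in> states n \<Longrightarrow> set_pmf (\<mu>' i) \<subseteq> U i"
      "\<And>i u. i \<in> states n \<Longrightarrow> u \<in> U i \<Longrightarrow> m i u = pmf (\<mu>' i) u"
      by (rule pmf_policy_exists[of "states n" U m]) (use finite_controls m in \<open>auto simp: policy_def\<close>)
    have SR: "\<mu>' \<in> SR_policies n U" using \<mu>'(1) by (simp add: SR_policies_def)
    have "Jcost n U V p g \<mu>' \<nu> i < \<infinity>" if "i \<in> states n" for i
      using bound[OF that] by (intro Jcost_less_infinity[of _ _ _ B]) (simp add: power cost \<mu>'(2))
    moreover have "prolonging n U V p \<mu>' \<nu>"
      using mass by (intro prolonging_if_mass_conserved[OF i]) (simp add: power \<mu>'(2))
    ultimately show False using not_prolonging_if_finite[OF SR \<nu> _ J[OF SR]] by blast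
  qed
qed

text \<open>The mirror image: player I is frozen, player II minimises the negated cost, and the
  potential changes sign at the end. Bounded negated costs bound the partial sums from below, and
  with them their liminf.\<close>

lemma upper_potential:
  obtains \<mu> L d where "\<mu> \<in> SR_policies n U" "L 0 = 0" "0 < d"
    "\<And>i v. i \<in> states n \<Longrightarrow> v \<in> V i \<Longrightarrow>
      (\<Sum>u\<in>U i. pmf (\<mu> i) u * (\<Sum>j\<in>{0..n}. p i u v j * (g i u v j + L j))) + d \<le> L i"
proof -
  obtain \<mu> \<nu> where \<mu>: "\<mu> \<in> SR_policies n U" and \<nu>: "\<nu> \<in> SR_policies n V"
    and J: "\<And>\<nu>' i. \<nu>' \<in> SR_policies n V \<Longrightarrow> i \<in> states n \<Longrightarrow> Jcost n U V p g \<mu> \<nu>' i < \<infinity>"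
    and terminating: "\<And>i. i \<in> states n \<Longrightarrow> \<exists>k. (\<Sum>l\<in>states n. kstep n U V p \<mu> \<nu> k i l) \<noteq> 1"
    by (rule security_policies) blast
  define q where "q i v j = (\<Sum>u\<in>U i. pmf (\<mu> i) u * p i u v j)" for i v j
  define r where "r i v = - (\<Sum>u\<in>U i. pmf (\<mu> i) u * (\<Sum>j\<in>{0..n}. p i u v j * g i u v j))" for i v
  interpret controlled_chain "states n" V q r
  proof
    fix i v assume iv: "i \<in> states n" "v \<in> V i"
    have "(\<Sum>j\<in>states n. q i v j) = (\<Sum>u\<in>U i. pmf (\<mu> i) u * (\<Sum>j\<in>states n. p i u v j))"
      unfolding q_def by (subst sum.swap) (simp add: sum_distrib_left)
    also have "\<dots> \<le> (\<Sum>u\<in>U i. pmf (\<mu> i) u * 1)"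
      using iv by (intro sum_mono mult_left_mono trans_states_le_1) auto
    finally show "(\<Sum>j\<in>states n. q i v j) \<le> 1" using SR_pmf_sum(1)[OF iv(1) \<mu>(1)] by simp
  qed (auto simp: q_def finite_states_set finite_controls states_def trans_prob intro!: sum_nonneg)
  have kernel: "kernel m i j = Ptrans U V p \<mu> \<nu>' i j"
    and cost: "cost m i = - stage_cost n U V p g \<mu> \<nu>' i"
    if m: "\<And>v. v \<in> V i \<Longrightarrow> m i v = pmf (\<nu>' i) v" for m \<nu>' i j
  proof -
    have "kernel m i j = (\<Sum>v\<in>V i. \<Sum>u\<in>U i. pmf (\<mu> i) u * pmf (\<nu>' i) v * p i u v j)"
      unfolding kernel_def q_def sum_distrib_left by (intro sum.cong) (auto simp: m mult_ac)
    then show "kernel m i j = Ptrans U V p \<mu> \<nu>' i j" unfolding Ptrans_def by (subst sum.swap) simp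
    have "cost m i = - (\<Sum>v\<in>V i. \<Sum>u\<in>U i. pmf (\<mu> i) u * pmf (\<nu>' i) v * (\<Sum>j\<in>{0..n}. p i u v j * g i u v j))"
      unfolding cost_def r_def mult_minus_right sum_negf sum_distrib_left[of _ _ "U i"]
      by (intro arg_cong[of _ _ uminus] sum.cong) (auto simp: m mult_ac)
    then show "cost m i = - stage_cost n U V p g \<mu> \<nu>' i" unfolding stage_cost_def by (subst sum.swap) simp
  qed
  have power: "chain_power (states n) (kernel m) k i l = kstep n U V p \<mu> \<nu>' k i l"
    if "\<And>i v. i \<in> states n \<Longrightarrow> v \<in> V i \<Longrightarrow> m i v = pmf (\<nu>' i) v" "l \<in> states n" for m \<nu>' k i l
    unfolding kstep_eq_chain_power by (intro chain_power_cong that(2) kernel that(1))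
  show ?thesis
  proof (rule subsolution_exists[of "\<lambda>i. pmf (\<nu> i)"])
    show "policy (\<lambda>i. pmf (\<nu> i))" using SR_pmf_sum(2)[OF _ \<nu>] by (simp add: policy_def)
    show "\<exists>k. (\<Sum>l\<in>states n. chain_power (states n) (kernel (\<lambda>i. pmf (\<nu> i))) k i l) \<noteq> 1" if "i \<in> states n" for i
      using terminating[OF that] by (simp add: power)
  next
    fix L d assume L: "0 < d" "\<And>i v. i \<in> states n \<Longrightarrow> v \<in> V i \<Longrightarrow> L i + d \<le> r i v + (\<Sum>j\<in>states n. q i v j * L j)"
    define L' where "L' j = (if j = 0 then 0 else - L j)" for j
    have L'0: "L' 0 = 0" by (simp add: L'_def)
    have L'_states: "L' i = - L i" if "i \<in> states n" for i using that by (simp add: L'_def states_def)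
    have "(\<Sum>u\<in>U i. pmf (\<mu> i) u * (\<Sum>j\<in>{0..n}. p i u v j * (g i u v j + L' j))) + d \<le> L' i"
      if "i \<in> states n" "v \<in> V i" for i v
      unfolding expected_cost_plus_potential[of L', OF L'0] using L(2)[OF that] that
      by (simp add: L'_states r_def sum_negf flip: q_def)
    then show ?thesis using that[of \<mu> L' d] \<mu> L(1) L'0 by blast
  next
    fix m i B
    assume m: "policy m" and i: "i \<in> states n"
      and mass: "\<And>k. (\<Sum>l\<in>states n. chain_power (states n) (kernel m) k i l) = 1"
      and bound: "\<And>i t. i \<in> states n \<Longrightarrow> (\<Sum>k\<le>t. \<Sum>l\<in>states n. chain_power (states n) (kernel m) k i l * cost m l) \<le> B"
    obtain \<nu>' where \<nu>': "\<And>i. i \<in> states n \<Longrightarrow> set_pmf (\<nu>' i) \<subseteq> V i"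
      "\<And>i v. i \<in> states n \<Longrightarrow> v \<in> V i \<Longrightarrow> m i v = pmf (\<nu>' i) v"
      by (rule pmf_policy_exists[of "states n" V m]) (use finite_controls m in \<open>auto simp: policy_def\<close>)
    have SR: "\<nu>' \<in> SR_policies n V" using \<nu>'(1) by (simp add: SR_policies_def)
    have "- \<infinity> < Jcost n U V p g \<mu> \<nu>' i" if "i \<in> states n" for i
    proof (rule Jcost_greater_minus_infinity)
      show "- B \<le> (\<Sum>k\<le>t. \<Sum>l\<in>states n. kstep n U V p \<mu> \<nu>' k i l * stage_cost n U V p g \<mu> \<nu>' l)" for t
        using bound[OF that, of t] by (simp add: power cost[of _ m \<nu>'] \<nu>'(2) sum_negf)
    qed
    moreover have "prolonging n U V p \<mu> \<nu>'"
      using mass by (intro prolonging_if_mass_conserved[OF i]) (simp add: power \<nu>'(2))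
    ultimately show False using not_prolonging_if_finite[OF \<mu> SR J[OF SR]] by blast
  qed
qed

end

section \<open>Boundedness of the iterates\<close>

lemma Qmix_bound:
  "\<bar>Qmix U V q s \<rho> \<sigma>\<bar> \<le> (\<Sum>u\<in>U s. \<Sum>v\<in>V s. \<bar>q (s, u, v)\<bar>)"
proof (cases "s = 0")
  case False
  have "\<bar>pmf \<rho> u * pmf \<sigma> v * q (s, u, v)\<bar> \<le> \<bar>q (s, u, v)\<bar>" for u v
    unfolding abs_mult by (simp add: mult_left_le_one_le mult_le_one pmf_le_1)
  then show ?thesis using False
    by (auto simp: Qmix_def intro!: order.trans[OF sum_abs] sum_mono)
qed (simp add: Qmix_def sum_nonneg)

lemma bdd_above_Qmix: "bdd_above (range (\<lambda>\<sigma>. Qmix U V q s \<rho> \<sigma>))"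
  by (rule bdd_aboveI2) (rule order.trans[OF abs_ge_self Qmix_bound])

lemma set_pmf_subset_nonempty: "x \<in> A \<Longrightarrow> {\<rho>. set_pmf \<rho> \<subseteq> A} \<noteq> {}"
  by (rule ex_in_conv[THEN iffD1], rule exI[of _ "return_pmf x"]) simp

text \<open>The inner supremum is at least its value at \<open>\<nu>\<close>, whatever
  \<open>\<rho>\<close> is, and averaging over \<open>\<rho>\<close> preserves the bound.\<close>

lemma minmax_val_lower:
  assumes "s \<noteq> 0" "finite (U s)" "U s \<noteq> {}" and \<nu>: "set_pmf \<nu> \<subseteq> V s"
    and le: "\<And>u. u \<in> U s \<Longrightarrow> a \<le> (\<Sum>v\<in>V s. pmf \<nu> v * q (s, u, v))"
  shows "a \<le> minmax_val U V q s"
proof -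
  obtain u0 where u0: "u0 \<in> U s" using assms by blast
  have "a \<le> (SUP \<sigma>\<in>{\<sigma>. set_pmf \<sigma> \<subseteq> V s}. Qmix U V q s \<rho> \<sigma>)" if "set_pmf \<rho> \<subseteq> U s" for \<rho>
  proof (rule cSUP_upper2[of _ _ \<nu>])
    have "a = (\<Sum>u\<in>U s. pmf \<rho> u * a)"
      using sum_pmf_eq_1[OF assms(2) that] by (simp flip: sum_distrib_right)
    also have "\<dots> \<le> (\<Sum>u\<in>U s. pmf \<rho> u * (\<Sum>v\<in>V s. pmf \<nu> v * q (s, u, v)))"
      by (intro sum_mono mult_left_mono le) auto
    finally show "a \<le> Qmix U V q s \<rho> \<nu>"
      using assms(1) by (simp add: Qmix_def sum_distrib_left mult.assoc)
    show "bdd_above ((\<lambda>\<sigma>. Qmix U V q s \<rho> \<sigma>) ` {\<sigma>. set_pmf \<sigma> \<subseteq> V s})"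
      by (rule bdd_above_mono[OF bdd_above_Qmix]) auto
  qed (use \<nu> in auto)
  moreover have "{\<rho>. set_pmf \<rho> \<subseteq> U s} \<noteq> {}" using u0 by (rule set_pmf_subset_nonempty)
  ultimately have "a \<le> (INF \<rho>\<in>{\<rho>. set_pmf \<rho> \<subseteq> U s}. SUP \<sigma>\<in>{\<sigma>. set_pmf \<sigma> \<subseteq> V s}. Qmix U V q s \<rho> \<sigma>)"
    by (intro cINF_greatest) blast+
  then show ?thesis using assms(1) by (simp add: minmax_val_def)
qed

lemma minmax_val_upper:
  assumes "s \<noteq> 0" "finite (V s)" "V s \<noteq> {}" and \<mu>: "set_pmf \<mu> \<subseteq> U s"
    and le: "\<And>v. v \<in> V s \<Longrightarrow> (\<Sum>u\<in>U s. pmf \<mu> u * q (s, u, v)) \<le> a"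
  shows "minmax_val U V q s \<le> a"
proof -
  obtain v0 where v0: "v0 \<in> V s" using assms by blast
  then have v0': "return_pmf v0 \<in> {\<sigma>. set_pmf \<sigma> \<subseteq> V s}" by simp
  let ?B = "\<Sum>u\<in>U s. \<Sum>v\<in>V s. \<bar>q (s, u, v)\<bar>"
  have "Qmix U V q s \<mu> \<sigma> \<le> a" if "set_pmf \<sigma> \<subseteq> V s" for \<sigma>
  proof -
    have "Qmix U V q s \<mu> \<sigma> = (\<Sum>v\<in>V s. pmf \<sigma> v * (\<Sum>u\<in>U s. pmf \<mu> u * q (s, u, v)))"
      using assms(1) unfolding Qmix_def sum_distrib_left by (subst sum.swap) (simp add: mult_ac)
    also have "\<dots> \<le> (\<Sum>v\<in>V s. pmf \<sigma> v * a)"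
      by (intro sum_mono mult_left_mono le) auto
    also have "\<dots> = a" using sum_pmf_eq_1[OF assms(2) that] by (simp flip: sum_distrib_right)
    finally show ?thesis .
  qed
  then have "(SUP \<sigma>\<in>{\<sigma>. set_pmf \<sigma> \<subseteq> V s}. Qmix U V q s \<mu> \<sigma>) \<le> a"
    using set_pmf_subset_nonempty[OF v0] by (intro cSUP_least) blast+
  \<comment> \<open>The infimum over the reals can be compared with its value at
    \<open>\<mu>\<close> only if it is bounded below; any single reply, here a point mass at
    \<open>v0\<close>, shows that.\<close>
  moreover have "- ?B \<le> (SUP \<sigma>\<in>{\<sigma>. set_pmf \<sigma> \<subseteq> V s}. Qmix U V q s \<rho> \<sigma>)" for \<rho>
    using Qmix_bound[of U V q s \<rho> "return_pmf v0"] v0'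
    by (intro cSUP_upper2[OF _ v0'] bdd_above_mono[OF bdd_above_Qmix]) (auto simp: abs_le_iff)
  then have "bdd_below ((\<lambda>\<rho>. SUP \<sigma>\<in>{\<sigma>. set_pmf \<sigma> \<subseteq> V s}. Qmix U V q s \<rho> \<sigma>) ` {\<rho>. set_pmf \<rho> \<subseteq> U s})"
    by (intro bdd_belowI2)
  ultimately show ?thesis
    using assms(1) \<mu> unfolding minmax_val_def by (auto intro: cINF_lower2)
qed

text \<open>A statement about a single path. \<open>step\<close> is assumed for every
  \<open>c \<ge> 0\<close> because \<open>c\<close> is chosen from the path, and its premise covers
  all earlier iterates because the update may use delayed ones.\<close>

lemma iterates_bounded_below:
  fixes Q :: "nat \<Rightarrow> 'l \<Rightarrow> real"
  assumes fin: "finite R" and d: "0 < d"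
    and \<gamma>: "\<And>t l. l \<in> R \<Longrightarrow> 0 \<le> \<gamma> t l \<and> \<gamma> t l \<le> 1"
    and noise: "\<And>l. l \<in> R \<Longrightarrow> \<exists>s. \<forall>t\<ge>s. \<bar>\<Sum>k\<in>{s..<t}. \<gamma> k l * w k l\<bar> \<le> d / 4"
    and step: "\<And>t c l. 0 \<le> c \<Longrightarrow> l \<in> R \<Longrightarrow> (\<And>\<tau> l'. \<tau> \<le> t \<Longrightarrow> l' \<in> R \<Longrightarrow> h l' - d - c \<le> Q \<tau> l') \<Longrightarrow>
        (1 - \<gamma> t l) * Q t l + \<gamma> t l * (h l + w t l - c) \<le> Q (Suc t) l"
  shows "\<exists>B. \<forall>t. \<forall>l\<in>R. B \<le> Q t l"
proof -
  obtain s where s: "\<And>l t. l \<in> R \<Longrightarrow> s l \<le> t \<Longrightarrow> \<bar>\<Sum>k\<in>{s l..<t}. \<gamma> k l * w k l\<bar> \<le> d / 4"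
    using noise by metis
  \<comment> \<open>A common starting time above every \<open>s l\<close>. A sum started at
    \<open>s0\<close> is a difference of two sums started at \<open>s l\<close>, which turns
    \<open>d / 4\<close> into \<open>d / 2\<close>.\<close>
  define s0 where "s0 = (\<Sum>l\<in>R. s l)"
  define S where "S t l = (\<Sum>k\<in>{s0..<t}. \<gamma> k l * w k l)" for t l
  have S: "\<bar>S t l\<bar> \<le> d / 2" if "s0 \<le> t" "l \<in> R" for t l
  proof -
    have "s l \<le> s0" unfolding s0_def using that fin by (intro member_le_sum) auto
    then have "(\<Sum>k\<in>{s l..<t}. \<gamma> k l * w k l) = (\<Sum>k\<in>{s l..<s0}. \<gamma> k l * w k l) + S t l"
      unfolding S_def using that by (simp add: sum.atLeastLessThan_concat)
    then show ?thesis using s[OF that(2), of t] s[OF that(2), of s0] \<open>s l \<le> s0\<close> that by linarith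
  qed
  define c where "c = (\<Sum>\<tau>\<le>s0. \<Sum>l\<in>R. \<bar>Q \<tau> l - h l\<bar>)"
  have c_nonneg: "0 \<le> c" by (simp add: c_def sum_nonneg)
  have init: "h l - c \<le> Q \<tau> l" if "\<tau> \<le> s0" "l \<in> R" for \<tau> l
  proof -
    have "\<bar>Q \<tau> l - h l\<bar> \<le> (\<Sum>l\<in>R. \<bar>Q \<tau> l - h l\<bar>)" using fin that by (intro member_le_sum) auto
    also have "\<dots> \<le> c" unfolding c_def using that by (intro member_le_sum) (auto intro: sum_nonneg)
    finally show ?thesis by linarith
  qed
  \<comment> \<open>The first half bounds the iterate with its accumulated noise removed; adding
    back noise of size at most \<open>d / 2\<close> gives the second half, which feeds the next
    step.\<close>
  have inv: "(\<forall>l\<in>R. - (d / 2) \<le> Q t l - h l + c - S t l) \<and> (\<forall>\<tau>\<le>t. \<forall>l\<in>R. h l - d - c \<le> Q \<tau> l)" if "s0 \<le> t" for t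
    using that
  proof (induction t rule: dec_induct)
    case base
    show ?case using init d by (force simp: S_def intro: order.trans[OF _ init])
  next
    case (step t)
    have new: "- (d / 2) \<le> Q (Suc t) l - h l + c - S (Suc t) l" if l: "l \<in> R" for l
    proof -
      have "(1 - \<gamma> t l) * Q t l + \<gamma> t l * (h l + w t l - c) \<le> Q (Suc t) l"
        using step.IH by (intro assms(5) c_nonneg l) blast
      moreover have "S (Suc t) l = S t l + \<gamma> t l * w t l" using step.hyps by (simp add: S_def)
      moreover have "(1 - \<gamma> t l) * (- (d / 2)) \<le> (1 - \<gamma> t l) * (Q t l - h l + c - S t l)"
        using step.IH l \<gamma>[OF l, of t] by (intro mult_left_mono) auto
      moreover have "\<gamma> t l * S t l \<le> \<gamma> t l * (d / 2)"
        using S[OF step.hyps(1) l] \<gamma>[OF l, of t] by (intro mult_left_mono) auto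
      \<comment> \<open>The new noise term cancels, leaving a lower bound by the convex combination
        of \<open>Q t l - h l + c - S t l\<close> and \<open>- S t l\<close> with weight
        \<open>\<gamma> t l\<close>; both are at least \<open>- (d / 2)\<close>.\<close>
      ultimately show ?thesis by (simp add: field_simps)
    qed
    moreover have "h l - d - c \<le> Q (Suc t) l" if l: "l \<in> R" for l
      using new[OF l] S[of "Suc t" l] step.hyps l by (simp add: abs_le_iff)
    ultimately show ?case using step.IH by (auto simp: le_Suc_eq)
  qed
  have "h l - d - c \<le> Q t l" if "l \<in> R" for t l
    using inv[of "max s0 t"] that by simp
  moreover have "- (\<Sum>l\<in>R. \<bar>h l\<bar>) \<le> h l" if "l \<in> R" for l
    using member_le_sum[of l R "\<lambda>l. \<bar>h l\<bar>"] that fin by (simp add: abs_le_iff)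
  ultimately have "- (\<Sum>l\<in>R. \<bar>h l\<bar>) - d - c \<le> Q t l" if "l \<in> R" for t l
    using that by (smt (verit))
  then show ?thesis by blast
qed

text \<open>Writing \<open>\<phi> (X t)\<close> as a finite combination of indicators reduces
  centring to the conditional probabilities of the successors, which are the constants
  \<open>P j\<close>.\<close>

lemma (in prob_space) sampling_noise_tail_small:
  fixes F :: "nat \<Rightarrow> 'a measure" and X :: "nat \<Rightarrow> 'a \<Rightarrow> 'b" and \<phi> :: "'b \<Rightarrow> real"
  assumes filt: "filtration (space M) F" and sub: "\<And>t. subalgebra M (F t)"
    and J: "finite J" "\<And>t \<omega>. \<omega> \<in> space M \<Longrightarrow> X t \<omega> \<in> J"
    and X_meas: "\<And>t. X t \<in> measurable (F (Suc t)) (count_space UNIV)"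
    and X_prob: "\<And>t j. j \<in> J \<Longrightarrow> AE \<omega> in M. real_cond_exp M (F t) (indicator {\<omega>' \<in> space M. X t \<omega>' = j}) \<omega> = P j"
    and c: "\<And>k. c k \<in> borel_measurable (F k)" "\<And>k \<omega>. \<omega> \<in> space M \<Longrightarrow> \<bar>c k \<omega>\<bar> \<le> 1"
    and sq: "AE \<omega> in M. summable (\<lambda>k. (c k \<omega>)\<^sup>2)" and x: "0 < x"
  shows "AE \<omega> in M. \<exists>s. \<forall>t\<ge>s. \<bar>\<Sum>k\<in>{s..<t}. c k \<omega> * (\<phi> (X k \<omega>) - (\<Sum>j\<in>J. P j * \<phi> j))\<bar> \<le> x"
proof -
  define h where "h = (\<Sum>j\<in>J. P j * \<phi> j)"
  interpret martingale_noise M F "\<lambda>t \<omega>. \<phi> (X t \<omega>) - h" "(\<Sum>j\<in>J. \<bar>\<phi> j\<bar>) + \<bar>h\<bar>"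
  proof (intro martingale_noise.intro martingale_noise_axioms.intro)
    show "prob_space M" by unfold_locales
    show "filtration (space M) F" by (rule filt)
    show "subalgebra M (F t)" for t by (rule sub)
    show "(\<lambda>\<omega>. \<phi> (X t \<omega>) - h) \<in> borel_measurable (F (Suc t))" for t
      using measurable_compose[OF X_meas, of \<phi> borel] by auto
    show "\<bar>\<phi> (X t \<omega>) - h\<bar> \<le> (\<Sum>j\<in>J. \<bar>\<phi> j\<bar>) + \<bar>h\<bar>" if "\<omega> \<in> space M" for t \<omega>
      using member_le_sum[of "X t \<omega>" J "\<lambda>j. \<bar>\<phi> j\<bar>"] J that by force
    fix Z :: "'a \<Rightarrow> real" and t and B :: real
    assume Z: "Z \<in> borel_measurable (F t)" "\<And>\<omega>. \<omega> \<in> space M \<Longrightarrow> \<bar>Z \<omega>\<bar> \<le> B"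
    have fs: "finite_measure_subalgebra M (F t)" by unfold_locales (use sub in auto)
    interpret sigma_finite_subalgebra M "F t" by (rule finite_measure_subalgebra_is_sigma_finite[OF fs])
    have [measurable]: "Z \<in> borel_measurable M" by (rule measurable_from_subalg[OF sub Z(1)])
    have [measurable]: "X t \<in> measurable M (count_space UNIV)" by (rule measurable_from_subalg[OF sub X_meas])
    have Z_int: "integrable M Z" by (rule integrable_const_bound[of _ B]) (use Z(2) in auto)
    define A where "A j = {\<omega> \<in> space M. X t \<omega> = j}" for j
    have [measurable]: "A j \<in> sets M" for j unfolding A_def by measurable
    have ZA_int: "integrable M (\<lambda>\<omega>. Z \<omega> * indicator (A j) \<omega>)" for j
      using integrable_mult_indicator[OF _ Z_int, of "A j"] by (simp add: mult.commute)
    have ZA: "(\<integral>\<omega>. Z \<omega> * indicator (A j) \<omega> \<partial>M) = P j * (\<integral>\<omega>. Z \<omega> \<partial>M)" if "j \<in> J" for j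
    proof -
      have "(\<integral>\<omega>. Z \<omega> * indicator (A j) \<omega> \<partial>M) = (\<integral>\<omega>. Z \<omega> * real_cond_exp M (F t) (indicator (A j)) \<omega> \<partial>M)"
        by (rule real_cond_exp_intg(2)[symmetric]) (use ZA_int Z in auto)
      also have "\<dots> = (\<integral>\<omega>. Z \<omega> * P j \<partial>M)"
        using X_prob[OF that, of t] by (intro integral_cong_AE) (auto simp: A_def)
      finally show ?thesis by simp
    qed
    have "(\<integral>\<omega>. Z \<omega> * (\<phi> (X t \<omega>) - h) \<partial>M) = (\<integral>\<omega>. (\<Sum>j\<in>J. \<phi> j * (Z \<omega> * indicator (A j) \<omega>)) - h * Z \<omega> \<partial>M)"
    proof (rule Bochner_Integration.integral_cong[OF refl])
      fix \<omega> assume \<omega>: "\<omega> \<in> space M"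
      have "(\<Sum>j\<in>J. \<phi> j * (Z \<omega> * indicator (A j) \<omega>)) = (\<Sum>j\<in>J. if j = X t \<omega> then \<phi> j * Z \<omega> else 0)"
        using \<omega> by (intro sum.cong) (auto simp: A_def)
      also have "\<dots> = \<phi> (X t \<omega>) * Z \<omega>" using J \<omega> by simp
      finally show "Z \<omega> * (\<phi> (X t \<omega>) - h) = (\<Sum>j\<in>J. \<phi> j * (Z \<omega> * indicator (A j) \<omega>)) - h * Z \<omega>"
        by (simp add: algebra_simps)
    qed
    also have "\<dots> = (\<Sum>j\<in>J. \<phi> j * (\<integral>\<omega>. Z \<omega> * indicator (A j) \<omega> \<partial>M)) - h * (\<integral>\<omega>. Z \<omega> \<partial>M)"
      using ZA_int Z_int by simp
    also have "\<dots> = 0" by (simp add: ZA h_def sum_distrib_right sum_distrib_left mult_ac)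
    finally show "(\<integral>\<omega>. Z \<omega> * (\<phi> (X t \<omega>) - h) \<partial>M) = 0" .
  qed
  show ?thesis using square_summable_wsum_tail_small[OF c sq x] by (simp add: h_def)
qed

theorem theorem3p1:
  fixes n :: nat
    and U :: "nat \<Rightarrow> 'u set" and V :: "nat \<Rightarrow> 'v set"
    and p :: "nat \<Rightarrow> 'u \<Rightarrow> 'v \<Rightarrow> nat \<Rightarrow> real"
    and g :: "nat \<Rightarrow> 'u \<Rightarrow> 'v \<Rightarrow> nat \<Rightarrow> real"
    and M :: "'w measure" and F :: "nat \<Rightarrow> 'w measure"
    and Q :: "nat \<Rightarrow> 'w \<Rightarrow> (nat \<times> 'u \<times> 'v) \<Rightarrow> real"
    and \<gamma> :: "nat \<Rightarrow> (nat \<times> 'u \<times> 'v) \<Rightarrow> 'w \<Rightarrow> real"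
    and \<tau> :: "nat \<Rightarrow> (nat \<times> 'u \<times> 'v) \<Rightarrow> (nat \<times> 'u \<times> 'v) \<Rightarrow> 'w \<Rightarrow> nat"
    and jsucc :: "nat \<Rightarrow> (nat \<times> 'u \<times> 'v) \<Rightarrow> 'w \<Rightarrow> nat"
  assumes game: "ssp_game n U V p"
    and model: "SSP_model_assumption n U V p g"
    and prob: "prob_space M"
    and filt: "filtration (space M) F" and subalg: "\<And>t. subalgebra M (F t)"
    \<comment> \<open>the Q-learning iteration\<close>
    and gamma_range: "\<And>t l \<omega>. l \<in> Rset n U V \<Longrightarrow> \<omega> \<in> space M \<Longrightarrow> 0 \<le> \<gamma> t l \<omega> \<and> \<gamma> t l \<omega> \<le> 1"
    and tau_le: "\<And>t l l' \<omega>. l \<in> Rset n U V \<Longrightarrow> l' \<in> Rset n U V \<Longrightarrow> \<omega> \<in> space M \<Longrightarrow>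
                   \<tau> t l l' \<omega> \<le> t"
    and succ_range: "\<And>t l \<omega>. l \<in> Rset n U V \<Longrightarrow> \<omega> \<in> space M \<Longrightarrow> jsucc t l \<omega> \<in> {0..n}"
    and iter: "\<And>t i u v \<omega>. (i, u, v) \<in> Rset n U V \<Longrightarrow> \<omega> \<in> space M \<Longrightarrow>
        Q (Suc t) \<omega> (i, u, v) =
          (1 - \<gamma> t (i, u, v) \<omega>) * Q t \<omega> (i, u, v)
          + \<gamma> t (i, u, v) \<omega> * (g i u v (jsucc t (i, u, v) \<omega>)
              + minmax_val U V (\<lambda>l'. Q (\<tau> t (i, u, v) l' \<omega>) \<omega> l') (jsucc t (i, u, v) \<omega>))"
    \<comment> \<open>algorithmic condition (i)\<close>
    and cond_i: "\<And>l. l \<in> Rset n U V \<Longrightarrow> (\<lambda>\<omega>. Q 0 \<omega> l) \<in> borel_measurable (F 0)"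
    \<comment> \<open>algorithmic condition (ii)\<close>
    and cond_ii_gamma: "\<And>t l. l \<in> Rset n U V \<Longrightarrow> \<gamma> t l \<in> borel_measurable (F t)"
    and cond_ii_tau: "\<And>t l l'. l \<in> Rset n U V \<Longrightarrow> l' \<in> Rset n U V \<Longrightarrow>
        \<tau> t l l' \<in> measurable (F t) (count_space UNIV)"
    \<comment> \<open>algorithmic condition (iii)\<close>
    and cond_iii_meas: "\<And>t l. l \<in> Rset n U V \<Longrightarrow> jsucc t l \<in> measurable (F (Suc t)) (count_space UNIV)"
    and cond_iii_prob: "\<And>t i u v j. (i, u, v) \<in> Rset n U V \<Longrightarrow> j \<in> {0..n} \<Longrightarrow>
        AE \<omega> in M. real_cond_exp M (F t)
            (indicator {\<omega>' \<in> space M. jsucc t (i, u, v) \<omega>' = j}) \<omega> = p i u v j"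
    \<comment> \<open>algorithmic condition (v)\<close>
    and cond_v: "AE \<omega> in M. \<forall>l\<in>Rset n U V.
        filterlim (\<lambda>T. \<Sum>t<T. \<gamma> t l \<omega>) at_top sequentially \<and>
        summable (\<lambda>t. (\<gamma> t l \<omega>)\<^sup>2)"
  shows "AE \<omega> in M. \<exists>B. \<forall>t. \<forall>l\<in>Rset n U V. \<bar>Q t \<omega> l\<bar> \<le> B"
proof -
  interpret prob_space M by (rule prob)
  interpret game_model n U V p g by unfold_locales (rule game, rule model)
  let ?R = "Rset n U V"
  have "?R \<subseteq> states n \<times> (\<Union>i\<in>states n. U i) \<times> (\<Union>i\<in>states n. V i)" by (auto simp: Rset_def)
  then have fin: "finite ?R"
    by (rule finite_subset) (use finite_controls finite_states_set in auto)
  define P where "P = (\<lambda>(i, u, v). p i u v)"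
  \<comment> \<open>Kept general in \<open>\<phi>\<close>, since the lower and upper bounds use
    different potentials.\<close>
  have noise: "AE \<omega> in M. \<forall>l\<in>?R. \<exists>s. \<forall>t\<ge>s.
      \<bar>\<Sum>k\<in>{s..<t}. \<gamma> k l \<omega> * (\<phi> l (jsucc k l \<omega>) - (\<Sum>j\<in>{0..n}. P l j * \<phi> l j))\<bar> \<le> x" if x: "0 < x" for \<phi> and x :: real
  proof (rule AE_finite_allI[OF fin])
    fix l assume l: "l \<in> ?R"
    show "AE \<omega> in M. \<exists>s. \<forall>t\<ge>s.
        \<bar>\<Sum>k\<in>{s..<t}. \<gamma> k l \<omega> * (\<phi> l (jsucc k l \<omega>) - (\<Sum>j\<in>{0..n}. P l j * \<phi> l j))\<bar> \<le> x"
    proof (rule sampling_noise_tail_small[OF filt subalg])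
      show "AE \<omega> in M. real_cond_exp M (F t) (indicator {\<omega>' \<in> space M. jsucc t l \<omega>' = j}) \<omega> = P l j"
        if "j \<in> {0..n}" for t j
        using cond_iii_prob[of "fst l" "fst (snd l)" "snd (snd l)" j t] l that by (simp add: P_def case_prod_beta)
      show "AE \<omega> in M. summable (\<lambda>k. (\<gamma> k l \<omega>)\<^sup>2)" using cond_v by eventually_elim (use l in auto)
      show "\<bar>\<gamma> k l \<omega>\<bar> \<le> 1" if "\<omega> \<in> space M" for k \<omega> using gamma_range[OF l that, of k] by simp
      show "jsucc t l \<omega> \<in> {0..n}" if "\<omega> \<in> space M" for t \<omega> by (rule succ_range[OF l that])
    qed (use l x cond_ii_gamma cond_iii_meas in auto)
  qed
  have iterate: "Q (Suc t) \<omega> l = (1 - \<gamma> t l \<omega>) * Q t \<omega> l + \<gamma> t l \<omega> *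
      (g i u v (jsucc t l \<omega>) + minmax_val U V (\<lambda>l'. Q (\<tau> t l l' \<omega>) \<omega> l') (jsucc t l \<omega>))"
    if "l = (i, u, v)" "l \<in> ?R" "\<omega> \<in> space M" for t l i u v \<omega>
    using iter that by blast

  have lower: "AE \<omega> in M. \<exists>B. \<forall>t. \<forall>l\<in>?R. B \<le> Q t \<omega> l"
  proof -
    obtain \<nu> L d where \<nu>: "\<nu> \<in> SR_policies n V" and L0: "L 0 = 0" and d: "0 < d"
      and L: "\<And>i u. i \<in> states n \<Longrightarrow> u \<in> U i \<Longrightarrow>
        L i + d \<le> (\<Sum>v\<in>V i. pmf (\<nu> i) v * (\<Sum>j\<in>{0..n}. p i u v j * (g i u v j + L j)))"
      by (rule lower_potential) blast
    define \<phi> where "\<phi> = (\<lambda>(i, u, v) j. g i u v j + L j)"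
    define h where "h l = (\<Sum>j\<in>{0..n}. P l j * \<phi> l j)" for l
    \<comment> \<open>Here the slack is spent: averaged against \<open>\<nu>\<close>,
      \<open>h\<close> exceeds \<open>L\<close> by at least \<open>d\<close>, so lowering every
      Q-factor by \<open>d\<close> costs nothing in the value. At termination, 0 is above
      \<open>- c\<close>.\<close>
    have value_bound: "L s - c \<le> minmax_val U V q s"
      if s: "s \<in> {0..n}" and c: "0 \<le> c" and q: "\<And>l. l \<in> ?R \<Longrightarrow> h l - d - c \<le> q l" for q s c
    proof (cases "s = 0")
      case True
      then show ?thesis using c L0 by (simp add: minmax_val_def)
    next
      case False
      then have s: "s \<in> states n" using s by (simp add: states_def)
      show ?thesis
      proof (rule minmax_val_lower[OF False])
        show "finite (U s)" "U s \<noteq> {}" using game s by (auto simp: ssp_game_def)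
        show "set_pmf (\<nu> s) \<subseteq> V s" using \<nu> s by (auto simp: SR_policies_def)
        fix u assume u: "u \<in> U s"
        have "L s - c \<le> (\<Sum>v\<in>V s. pmf (\<nu> s) v * h (s, u, v)) - (d + c) * (\<Sum>v\<in>V s. pmf (\<nu> s) v)"
          using L[OF s u] SR_pmf_sum(2)[OF s \<nu>] by (simp add: h_def P_def \<phi>_def)
        also have "\<dots> = (\<Sum>v\<in>V s. pmf (\<nu> s) v * (h (s, u, v) - d - c))"
          by (simp add: sum_distrib_left algebra_simps sum_subtractf sum.distrib)
        also have "\<dots> \<le> (\<Sum>v\<in>V s. pmf (\<nu> s) v * q (s, u, v))"
          using s u by (intro sum_mono mult_left_mono q) (auto simp: Rset_def)
        finally show "L s - c \<le> (\<Sum>v\<in>V s. pmf (\<nu> s) v * q (s, u, v))" .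
      qed
    qed
    have "AE \<omega> in M. \<forall>l\<in>?R. \<exists>s. \<forall>t\<ge>s.
        \<bar>\<Sum>k\<in>{s..<t}. \<gamma> k l \<omega> * (\<phi> l (jsucc k l \<omega>) - h l)\<bar> \<le> d / 4"
      unfolding h_def using d by (intro noise) simp
    with AE_space show ?thesis
    proof eventually_elim
      case (elim \<omega>)
      show ?case
      proof (rule iterates_bounded_below[OF fin d, where \<gamma> = "\<lambda>t l. \<gamma> t l \<omega>" and h = h
            and w = "\<lambda>t l. \<phi> l (jsucc t l \<omega>) - h l"])
        fix t c l
        assume c: "0 \<le> c" and l: "l \<in> ?R"
          and Q: "\<And>\<tau> l'. \<tau> \<le> t \<Longrightarrow> l' \<in> ?R \<Longrightarrow> h l' - d - c \<le> Q \<tau> \<omega> l'"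
        obtain i u v where iuv: "l = (i, u, v)" by (cases l)
        have "L (jsucc t l \<omega>) - c \<le> minmax_val U V (\<lambda>l'. Q (\<tau> t l l' \<omega>) \<omega> l') (jsucc t l \<omega>)"
          using succ_range[OF l elim(1)] c Q tau_le[OF l _ elim(1)] by (intro value_bound) auto
        then have "\<gamma> t l \<omega> * (\<phi> l (jsucc t l \<omega>) - c) \<le> \<gamma> t l \<omega> *
            (g i u v (jsucc t l \<omega>) + minmax_val U V (\<lambda>l'. Q (\<tau> t l l' \<omega>) \<omega> l') (jsucc t l \<omega>))"
          using gamma_range[OF l elim(1), of t] by (intro mult_left_mono) (auto simp: \<phi>_def iuv)
        then show "(1 - \<gamma> t l \<omega>) * Q t \<omega> l + \<gamma> t l \<omega> * (h l + (\<phi> l (jsucc t l \<omega>) - h l) - c) \<le> Q (Suc t) \<omega> l"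
          by (simp add: iterate[OF iuv l elim(1)])
      qed (use elim gamma_range in auto)
    qed
  qed

  have upper: "AE \<omega> in M. \<exists>B. \<forall>t. \<forall>l\<in>?R. B \<le> - Q t \<omega> l"
  proof -
    obtain \<mu> L d where \<mu>: "\<mu> \<in> SR_policies n U" and L0: "L 0 = 0" and d: "0 < d"
      and L: "\<And>i v. i \<in> states n \<Longrightarrow> v \<in> V i \<Longrightarrow>
        (\<Sum>u\<in>U i. pmf (\<mu> i) u * (\<Sum>j\<in>{0..n}. p i u v j * (g i u v j + L j))) + d \<le> L i"
      by (rule upper_potential) blast
    \<comment> \<open>The sign makes the comparison for lower bounds applicable to the negated
      iterates.\<close>
    define \<phi> where "\<phi> = (\<lambda>(i, u, v) j. - (g i u v j + L j))"
    define h where "h l = (\<Sum>j\<in>{0..n}. P l j * \<phi> l j)" for l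
    have h: "h (i, u, v) = - (\<Sum>j\<in>{0..n}. p i u v j * (g i u v j + L j))" for i u v
      unfolding h_def P_def \<phi>_def prod.case mult_minus_right sum_negf ..
    have value_bound: "minmax_val U V q s \<le> L s + c"
      if s: "s \<in> {0..n}" and c: "0 \<le> c" and q: "\<And>l. l \<in> ?R \<Longrightarrow> h l - d - c \<le> - q l" for q s c
    proof (cases "s = 0")
      case True
      then show ?thesis using c L0 by (simp add: minmax_val_def)
    next
      case False
      then have s: "s \<in> states n" using s by (simp add: states_def)
      show ?thesis
      proof (rule minmax_val_upper[OF False])
        show "finite (V s)" "V s \<noteq> {}" using game s by (auto simp: ssp_game_def)
        show "set_pmf (\<mu> s) \<subseteq> U s" using \<mu> s by (auto simp: SR_policies_def)
        fix v assume v: "v \<in> V s"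
        have "q (s, u, v) \<le> - h (s, u, v) + d + c" if "u \<in> U s" for u
          using q[of "(s, u, v)"] s v that by (auto simp: Rset_def)
        then have "(\<Sum>u\<in>U s. pmf (\<mu> s) u * q (s, u, v)) \<le> (\<Sum>u\<in>U s. pmf (\<mu> s) u * (- h (s, u, v) + d + c))"
          by (intro sum_mono mult_left_mono) auto
        also have "\<dots> = (\<Sum>u\<in>U s. pmf (\<mu> s) u * - h (s, u, v)) + (d + c) * (\<Sum>u\<in>U s. pmf (\<mu> s) u)"
          by (simp add: sum_distrib_left algebra_simps sum_subtractf sum.distrib sum_negf)
        also have "\<dots> \<le> L s + c"
          using L[OF s v] SR_pmf_sum(1)[OF s \<mu>] by (simp add: h)
        finally show "(\<Sum>u\<in>U s. pmf (\<mu> s) u * q (s, u, v)) \<le> L s + c" .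
      qed
    qed
    have "AE \<omega> in M. \<forall>l\<in>?R. \<exists>s. \<forall>t\<ge>s.
        \<bar>\<Sum>k\<in>{s..<t}. \<gamma> k l \<omega> * (\<phi> l (jsucc k l \<omega>) - h l)\<bar> \<le> d / 4"
      unfolding h_def using d by (intro noise) simp
    with AE_space show ?thesis
    proof eventually_elim
      case (elim \<omega>)
      show ?case
      proof (rule iterates_bounded_below[OF fin d, where \<gamma> = "\<lambda>t l. \<gamma> t l \<omega>" and h = h
            and w = "\<lambda>t l. \<phi> l (jsucc t l \<omega>) - h l"])
        fix t c l
        assume c: "0 \<le> c" and l: "l \<in> ?R"
          and Q: "\<And>\<tau> l'. \<tau> \<le> t \<Longrightarrow> l' \<in> ?R \<Longrightarrow> h l' - d - c \<le> - Q \<tau> \<omega> l'"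
        obtain i u v where iuv: "l = (i, u, v)" by (cases l)
        have "minmax_val U V (\<lambda>l'. Q (\<tau> t l l' \<omega>) \<omega> l') (jsucc t l \<omega>) \<le> L (jsucc t l \<omega>) + c"
          using succ_range[OF l elim(1)] c Q tau_le[OF l _ elim(1)] by (intro value_bound) auto
        then have "\<gamma> t l \<omega> * (\<phi> l (jsucc t l \<omega>) - c) \<le> \<gamma> t l \<omega> *
            - (g i u v (jsucc t l \<omega>) + minmax_val U V (\<lambda>l'. Q (\<tau> t l l' \<omega>) \<omega> l') (jsucc t l \<omega>))"
          using gamma_range[OF l elim(1), of t] by (intro mult_left_mono) (auto simp: \<phi>_def iuv)
        then have "\<gamma> t l \<omega> * (\<phi> l (jsucc t l \<omega>) - c) \<le> - (\<gamma> t l \<omega> *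
            (g i u v (jsucc t l \<omega>) + minmax_val U V (\<lambda>l'. Q (\<tau> t l l' \<omega>) \<omega> l') (jsucc t l \<omega>)))"
          by (simp only: mult_minus_right)
        then show "(1 - \<gamma> t l \<omega>) * - Q t \<omega> l + \<gamma> t l \<omega> * (h l + (\<phi> l (jsucc t l \<omega>) - h l) - c) \<le> - Q (Suc t) \<omega> l"
          by (simp add: iterate[OF iuv l elim(1)])
      qed (use elim gamma_range in auto)
    qed
  qed

  from lower upper show ?thesis
  proof eventually_elim
    case (elim \<omega>)
    then obtain B B' where "\<And>t l. l \<in> ?R \<Longrightarrow> B \<le> Q t \<omega> l" "\<And>t l. l \<in> ?R \<Longrightarrow> B' \<le> - Q t \<omega> l" by blast
    then have "\<bar>Q t \<omega> l\<bar> \<le> max (- B) (- B')" if "l \<in> ?R" for t l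
      using that by (smt (verit))
    then show ?case by blast
  qed
qed

end
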